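(* Let $G$ be a unicyclic graph on $n$ vertices. Let $G^{(1)}=C_3S(n-3,0,0)$ and $G^{(2)}=C_3S(n-4,1,0)$. If $G\not\cong G^{(1)}$, then $$SLEE(G)\le SLEE(G^{(2)})<SLEE(G^{(1)}),$$ with equality in the left part if and only if $G\cong G^{(2)}$.
   Context: All graphs are simple, finite and undirected. For a graph $G$ on $n$ vertices, the signless Laplacian matrix is $Q=D+A$, where $A$ is the adjacency matrix and $D$ is the diagonal matrix of vertex degrees. If $q_1,\dots,q_n$ are the eigenvalues of $Q$ (with multiplicity), the signless Laplacian Estrada index is $SLEE(G)=\sum_{i=1}^n e^{q_i}$. A unicyclic graph is a connected graph with the same number of vertices and edges (hence a connected graph with a unique cycle). For $q\ge 3$ and integers $n_1,\dots,n_q\ge 0$, $C_qS(n_1,\dots,n_q)$ denotes the graph obtained from a cycle $C_q=v_1v_2\cdots v_qv_1$ by attaching $n_i$ pendent vertices (vertices of degree 1) to $v_i$ for each $i=1,\dots,q$.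
   Formalization: The strict inequality SLEE(G^(2)) < SLEE(G^(1)) is stated only for n ≥ 5, since for n = 4 (e.g. G = C_4) the graphs G^(1) and G^(2) are isomorphic and it fails; the left inequality and its equality case are stated for every n. *)

theory Defs
  imports
    Complex_Main
    "Jordan_Normal_Form.Char_Poly"
    "Graph_Theory.Graph_Theory"
begin

text \<open>
  A finite simple undirected graph is a \<open>pair_graph\<close>: a finite set \<open>pverts\<close> of vertices with a
  symmetric irreflexive adjacency relation \<open>parcs\<close>.  Each edge occurs in \<open>parcs\<close> in both
  orientations, so that \<open>edges\<close> identifies the two, and the degree of a vertex is its out-degree.
\<close>

definition edges :: "'a pair_pre_digraph \<Rightarrow> 'a set set" where
  "edges G = {{u, v} | u v. (u, v) \<in> parcs G}"

definition unicyclic :: "'a pair_pre_digraph \<Rightarrow> bool" where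
  "unicyclic G \<longleftrightarrow>
     pair_graph G \<and> connected (with_proj G) \<and> card (edges G) = card (pverts G)"

definition graph_iso :: "'a pair_pre_digraph \<Rightarrow> 'b pair_pre_digraph \<Rightarrow> bool" where
  "graph_iso G H \<longleftrightarrow> digraph_iso (with_proj G) (with_proj H)"

text \<open>The matrices depend on an ordering \<open>xs\<close> of the vertices.\<close>

definition adjacency_matrix :: "'a pair_pre_digraph \<Rightarrow> 'a list \<Rightarrow> real mat" where
  "adjacency_matrix G xs =
     mat (length xs) (length xs) (\<lambda>(i, j). if (xs ! i, xs ! j) \<in> parcs G then 1 else 0)"

definition degree_matrix :: "'a pair_pre_digraph \<Rightarrow> 'a list \<Rightarrow> real mat" where
  "degree_matrix G xs =
     mat (length xs) (length xs)
       (\<lambda>(i, j). if i = j then real (out_degree (with_proj G) (xs ! i)) else 0)"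

definition signless_laplacian :: "'a pair_pre_digraph \<Rightarrow> 'a list \<Rightarrow> real mat" where
  "signless_laplacian G xs = degree_matrix G xs + adjacency_matrix G xs"

definition vertex_list :: "'a pair_pre_digraph \<Rightarrow> 'a list" where
  "vertex_list G = (SOME xs. distinct xs \<and> set xs = pverts G)"

text \<open>
  Another ordering of the vertices conjugates the matrix by a permutation matrix, so the choice in
  \<open>vertex_list\<close> does not affect its spectrum.  The matrix is real symmetric, so all its
  eigenvalues are real, and the multiset of real roots of its characteristic polynomial is its
  full spectrum with multiplicities.
\<close>

definition SLEE :: "'a pair_pre_digraph \<Rightarrow> real" where
  "SLEE G = (\<Sum>q\<in>#proots (char_poly (signless_laplacian G (vertex_list G))). exp q)"

text \<open>
  \<open>CS [n\<^sub>1, \<dots>, n\<^sub>q]\<close> is the graph \<open>C\<^sub>qS(n\<^sub>1, \<dots>, n\<^sub>q)\<close>, meaningful for \<open>q \<ge> 3\<close>.  Indices are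
  shifted to start from 0: \<open>(i, 0)\<close> is the \<open>i\<close>-th cycle vertex, and \<open>(i, k)\<close> with
  \<open>1 \<le> k \<le> ns ! i\<close> are the pendent vertices attached to it.
\<close>

definition CS :: "nat list \<Rightarrow> (nat \<times> nat) pair_pre_digraph" where
  "CS ns =
     (let E = {((i, 0), (Suc i mod length ns, 0)) | i. i < length ns}
            \<union> {((i, 0), (i, k)) | i k. i < length ns \<and> 1 \<le> k \<and> k \<le> ns ! i}
      in \<lparr> pverts = {(i, k). i < length ns \<and> k \<le> ns ! i}, parcs = E \<union> E\<inverse> \<rparr>)"

end

theory Submission
  imports Defs "Jordan_Normal_Form.Schur_Decomposition"
begin

text \<open>
  Since \<open>Q\<close> is real symmetric, \<open>SLEE(G) = \<Sum>\<^sub>k tr(Q\<^sup>k) / k!\<close>,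
  so it suffices to compare all traces of powers, with one of them strict. All comparisons come from one
  principle. Let an involution \<open>\<tau>\<close> of the vertices exchange two sides and fix the
  remaining vertices, and write \<open>Q\<close> in the orthonormal basis of the vectors
  \<open>(e\<^sub>x + e\<^sub>\<tau>\<^sub>x) / \<surd>2\<close> and \<open>(e\<^sub>x -
  e\<^sub>\<tau>\<^sub>x) / \<surd>2\<close>, together with \<open>e\<^sub>x\<close> for the fixed
  vertices. Suppose that every edge crossing between the sides joins some \<open>x\<close> to
  \<open>\<tau> x\<close>. An edge on the second side and its mirror image on the first side contribute
  the same entries up to sign, and the contribution of the first side is nonnegative. Hence replacing
  unpaired edges of the second side by their mirror images turns the transformed matrix into one that
  dominates the absolute values of the old one entrywise, and no trace of a power decreases
  (\<open>trace_pow_reflect_mono\<close>, \<open>trace_pow_shift\<close>). The trace of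
  \<open>Q\<^sup>2\<close> is the sum of the squared degrees plus the number of arcs, which makes the
  increase strict (\<open>slee_shift_less\<close>).

  For \<open>\<tau> = (u v)\<close> this is the Kelmans transformation: the neighbours of
  \<open>v\<close> that are private, that is, not shared with \<open>u\<close>, move to
  \<open>u\<close>. It preserves being unicyclic if \<open>u\<close> and \<open>v\<close> are adjacent
  or share a neighbour. The graph \<open>G\<^sup>(\<^sup>1\<^sup>)\<close> is the unicyclic graph with a
  dominating vertex (\<open>unicyc_dominating_is_tri\<close>), and a Kelmans transformation creates a
  dominating vertex only if \<open>u\<close> and \<open>v\<close> are adjacent and their neighbourhoods
  cover all vertices. Take a unicyclic graph without dominating vertex that has the largest index among
  these graphs. Every other strict Kelmans transformation that keeps the graph unicyclic would
  contradict maximality. Applied around a vertex of largest degree, this forces the graph to be a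
  triangle with pendent vertices at two of its vertices, and then the involution \<open>(u v)(p
  q)\<close>, with \<open>p\<close> and \<open>q\<close> pendent at \<open>u\<close> and
  \<open>v\<close>, shows that only one pendent vertex is at \<open>v\<close>
  (\<open>maximal_no_dominating_is_tri\<close>). This graph is \<open>G\<^sup>(\<^sup>2\<^sup>)\<close>,
  and one more transformation leads from it to \<open>G\<^sup>(\<^sup>1\<^sup>)\<close>.

  On four vertices \<open>G\<^sup>(\<^sup>1\<^sup>)\<close> and \<open>G\<^sup>(\<^sup>2\<^sup>)\<close>
  are isomorphic, so there the comparison class contains all unicyclic graphs.
\<close>

section \<open>Traces of powers and the spectrum of a symmetric matrix\<close>

lemma upper_triangular_pow:
  fixes B :: "'a :: comm_ring_1 mat"
  assumes B: "B \<in> carrier_mat n n" and ut: "upper_triangular B"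
  shows "upper_triangular (B ^\<^sub>m k) \<and> (\<forall>i<n. (B ^\<^sub>m k) $$ (i, i) = (B $$ (i, i)) ^ k)"
proof (induction k)
  case 0
  then show ?case using B by (auto simp: upper_triangular_def)
next
  case (Suc k)
  have Bk: "B ^\<^sub>m k \<in> carrier_mat n n" using B by simp
  have entry: "(B ^\<^sub>m Suc k) $$ (i, j) = (\<Sum>l<n. (B ^\<^sub>m k) $$ (i, l) * B $$ (l, j))" if "i < n" "j < n" for i j
    using B Bk that by (simp add: scalar_prod_def atLeast0LessThan)
  have z1: "(B ^\<^sub>m k) $$ (i, l) = 0" if "l < i" "i < n" for i l
    using Suc Bk that by (auto simp: upper_triangular_def)
  have z2: "B $$ (l, j) = 0" if "j < l" "l < n" for l j
    using ut B that by (auto simp: upper_triangular_def)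
  have "(B ^\<^sub>m Suc k) $$ (i, j) = 0" if "j < i" "i < n" for i j
  proof -
    have "(B ^\<^sub>m k) $$ (i, l) * B $$ (l, j) = 0" if "l < n" for l
      using z1[of l i] z2[of j l] \<open>j < i\<close> \<open>i < n\<close> that by (cases "l < i") auto
    then show ?thesis using entry[of i j] that by simp
  qed
  moreover have "(B ^\<^sub>m Suc k) $$ (i, i) = (B $$ (i, i)) ^ Suc k" if i: "i < n" for i
  proof -
    have "(\<Sum>l<n. (B ^\<^sub>m k) $$ (i, l) * B $$ (l, i)) = (\<Sum>l\<in>{i}. (B ^\<^sub>m k) $$ (i, l) * B $$ (l, i))"
    proof (rule sum.mono_neutral_right)
      show "\<forall>l\<in>{..<n} - {i}. (B ^\<^sub>m k) $$ (i, l) * B $$ (l, i) = 0"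
      proof
        fix l assume "l \<in> {..<n} - {i}"
        then show "(B ^\<^sub>m k) $$ (i, l) * B $$ (l, i) = 0"
          using z1[of l i] z2[of i l] i by (cases "l < i") auto
      qed
    qed (use i in auto)
    then show ?thesis using entry[OF i i] Suc i by (simp add: mult.commute)
  qed
  ultimately show ?case using B by (auto simp: upper_triangular_def)
qed

lemma trace_mult_commute:
  fixes A B :: "'a :: comm_ring_1 mat"
  assumes "A \<in> carrier_mat n n" "B \<in> carrier_mat n n"
  shows "(\<Sum>i<n. (A * B) $$ (i, i)) = (\<Sum>i<n. (B * A) $$ (i, i))"
proof -
  have "(\<Sum>i<n. (A * B) $$ (i, i)) = (\<Sum>i<n. \<Sum>j<n. A $$ (i, j) * B $$ (j, i))"
    using assms by (auto simp: scalar_prod_def atLeast0LessThan)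
  also have "\<dots> = (\<Sum>j<n. \<Sum>i<n. B $$ (j, i) * A $$ (i, j))"
    by (subst sum.swap) (simp add: mult.commute)
  also have "\<dots> = (\<Sum>i<n. (B * A) $$ (i, i))"
    using assms by (auto simp: scalar_prod_def atLeast0LessThan)
  finally show ?thesis .
qed

text \<open>
  Over the complex numbers the characteristic polynomial splits. A root \<open>a\<close> with
  eigenvector \<open>v\<close> is real because \<open>v\<^sup>* A v = a
  \<parallel>v\<parallel>\<^sup>2\<close> equals its own conjugate, so the linear factors descend to the
  reals.
\<close>

lemma real_symmetric_char_poly_splits:
  fixes A :: "real mat"
  assumes A: "A \<in> carrier_mat n n"
    and sym: "\<And>i j. i < n \<Longrightarrow> j < n \<Longrightarrow> A $$ (i, j) = A $$ (j, i)"
  shows "\<exists>rs. char_poly A = (\<Prod>r\<leftarrow>rs. [:- r, 1:])"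
proof -
  interpret hp: map_poly_inj_comm_ring_hom complex_of_real ..
  define C where "C = map_mat complex_of_real A"
  have C: "C \<in> carrier_mat n n" using A by (simp add: C_def)
  have cC: "char_poly C = map_poly complex_of_real (char_poly A)"
    unfolding C_def by (rule of_real_hom.char_poly_hom[OF A])
  obtain as where as: "char_poly C = (\<Prod>a\<leftarrow>as. [:- a, 1:])" "length as = n"
    using char_poly_factorized[OF C] by auto
  have real: "a = complex_of_real (Re a)" if "a \<in> set as" for a
  proof -
    have "poly (char_poly C) a = 0"
      using that unfolding as(1) by (force simp: poly_prod_list prod_list_zero_iff)
    then obtain v where v: "v \<in> carrier_vec n" "v \<noteq> 0\<^sub>v n" "C *\<^sub>v v = a \<cdot>\<^sub>v v"
      using C unfolding eigenvalue_root_char_poly[OF C, symmetric] eigenvalue_def eigenvector_def by auto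
    have row: "(\<Sum>j<n. complex_of_real (A $$ (i, j)) * v $ j) = a * v $ i" if "i < n" for i
    proof -
      have "(C *\<^sub>v v) $ i = (a \<cdot>\<^sub>v v) $ i" using v by simp
      then show ?thesis using that C v A
        by (simp add: scalar_prod_def atLeast0LessThan C_def)
    qed
    define N where "N = (\<Sum>i<n. (cmod (v $ i))\<^sup>2)"
    \<comment> \<open>The Hermitian form \<open>v\<^sup>* A v\<close>.\<close>
    define T where "T = (\<Sum>i<n. \<Sum>j<n. cnj (v $ i) * complex_of_real (A $$ (i, j)) * v $ j)"
    have T: "T = a * complex_of_real N"
    proof -
      have "T = (\<Sum>i<n. cnj (v $ i) * (\<Sum>j<n. complex_of_real (A $$ (i, j)) * v $ j))"
        by (simp add: T_def sum_distrib_left mult.assoc)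
      also have "\<dots> = (\<Sum>i<n. cnj (v $ i) * (a * v $ i))" using row by simp
      also have "\<dots> = (\<Sum>i<n. a * complex_of_real ((cmod (v $ i))\<^sup>2))"
        by (intro sum.cong refl) (simp add: complex_norm_square mult_ac del: of_real_power)
      also have "\<dots> = a * complex_of_real N" by (simp add: N_def sum_distrib_left)
      finally show ?thesis .
    qed
    have "cnj T = (\<Sum>i<n. \<Sum>j<n. cnj (v $ j) * complex_of_real (A $$ (i, j)) * v $ i)"
      by (simp add: T_def mult_ac)
    also have "\<dots> = T"
      unfolding T_def by (subst sum.swap) (intro sum.cong refl, simp add: sym)
    finally have "cnj a * complex_of_real N = a * complex_of_real N" using T by simp
    moreover have "N > 0"
    proof -
      obtain i where i: "i < n" "v $ i \<noteq> 0"
        using v(1,2) by (metis carrier_vecD eq_vecI index_zero_vec(1,2))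
      have "(cmod (v $ i))\<^sup>2 \<le> N" unfolding N_def by (rule member_le_sum) (use i in auto)
      moreover have "(cmod (v $ i))\<^sup>2 > 0" using i by simp
      ultimately show ?thesis by linarith
    qed
    ultimately have "cnj a = a" by simp
    then show ?thesis by (metis Reals_cnj_iff complex_is_Real_iff of_real_Re)
  qed
  have "map_poly complex_of_real (char_poly A) = (\<Prod>a\<leftarrow>map (\<lambda>r. complex_of_real (Re r)) as. [:- a, 1:])"
    using real as(1) cC by (metis map_idI)
  also have "\<dots> = map_poly complex_of_real (\<Prod>r\<leftarrow>map Re as. [:- r, 1:])"
    by (simp add: hp.hom_prod_list o_def)
  finally have "char_poly A = (\<Prod>r\<leftarrow>map Re as. [:- r, 1:])" by (rule hp.injectivity)
  then show ?thesis by blast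
qed

text \<open>
  A Schur triangularisation turns the traces of powers into power sums of the eigenvalues, and the
  exponential series does the rest.
\<close>

lemma sum_exp_proots_char_poly:
  fixes A :: "real mat"
  assumes A: "A \<in> carrier_mat n n"
    and sym: "\<And>i j. i < n \<Longrightarrow> j < n \<Longrightarrow> A $$ (i, j) = A $$ (j, i)"
  shows "(\<lambda>k. (\<Sum>i<n. (A ^\<^sub>m k) $$ (i, i)) / fact k) sums (\<Sum>q\<in>#proots (char_poly A). exp q)"
proof -
  obtain rs where rs: "char_poly A = (\<Prod>r\<leftarrow>rs. [:- r, 1:])"
    using real_symmetric_char_poly_splits[OF A sym] by blast
  obtain B P Q where BPQ: "schur_decomposition A rs = (B, P, Q)"
    by (metis prod_cases3)
  from schur_decomposition[OF A rs BPQ]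
  have wit: "similar_mat_wit A B P Q" and ut: "upper_triangular B" and diag: "diag_mat B = rs" by auto
  from similar_mat_witD2[OF A wit]
  have B: "B \<in> carrier_mat n n" and P: "P \<in> carrier_mat n n" and Q: "Q \<in> carrier_mat n n"
    and QP: "Q * P = 1\<^sub>m n" by auto
  have power_sum: "(\<Sum>i<n. (A ^\<^sub>m k) $$ (i, i)) = (\<Sum>r\<leftarrow>rs. r ^ k)" for k
  proof -
    have Bk: "B ^\<^sub>m k \<in> carrier_mat n n" using B by simp
    have "(\<Sum>i<n. (A ^\<^sub>m k) $$ (i, i)) = (\<Sum>i<n. ((P * B ^\<^sub>m k) * Q) $$ (i, i))"
      by (simp add: similar_mat_wit_pow_id[OF wit])
    also have "\<dots> = (\<Sum>i<n. (Q * (P * B ^\<^sub>m k)) $$ (i, i))"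
      by (rule trace_mult_commute) (use P Q Bk in auto)
    also have "Q * (P * B ^\<^sub>m k) = B ^\<^sub>m k"
      by (metis assoc_mult_mat[OF Q P Bk] QP left_mult_one_mat[OF Bk])
    also have "(\<Sum>i<n. (B ^\<^sub>m k) $$ (i, i)) = (\<Sum>i<n. (B $$ (i, i)) ^ k)"
      using upper_triangular_pow[OF B ut, of k] by simp
    also have "\<dots> = (\<Sum>r\<leftarrow>rs. r ^ k)"
      using B unfolding diag[symmetric] diag_mat_def
      by (simp add: o_def interv_sum_list_conv_sum_set_nat atLeast0LessThan)
    finally show ?thesis .
  qed
  have "proots (char_poly A) = mset rs"
    unfolding rs
  proof (induction rs)
    case (Cons r rs)
    have "(\<Prod>r\<leftarrow>rs. [:- r, 1:]) \<noteq> 0" by (auto simp: prod_list_zero_iff)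
    then have "proots ([:- r, 1:] * (\<Prod>r\<leftarrow>rs. [:- r, 1:])) = mset (r # rs)"
      using Cons by (subst proots_mult) auto
    then show ?case by (simp del: mult_pCons_left)
  qed simp
  then have "(\<Sum>q\<in>#proots (char_poly A). exp q) = (\<Sum>r\<leftarrow>rs. exp r)"
    by (metis mset_map sum_mset_sum_list)
  moreover have "(\<lambda>k. (\<Sum>r\<leftarrow>rs. r ^ k) / fact k) sums (\<Sum>r\<leftarrow>rs. exp r)"
  proof (induction rs)
    case (Cons r rs)
    have "(\<lambda>k. r ^ k / fact k) sums exp r"
      using exp_converges[of r] by (simp add: divide_inverse mult.commute)
    from sums_add[OF this Cons] show ?case by (simp add: add_divide_distrib)
  qed auto
  ultimately show ?thesis by (simp add: power_sum)
qed

section \<open>Comparing traces by reflection\<close>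

text \<open>
  Matrices indexed directly by vertices, so that the comparisons do not depend on an ordering of the
  vertices.
\<close>

primrec fun_mat_pow :: "'a set \<Rightarrow> ('a \<Rightarrow> 'a \<Rightarrow> real) \<Rightarrow> nat \<Rightarrow> 'a \<Rightarrow> 'a \<Rightarrow> real" where
  "fun_mat_pow V M 0 = (\<lambda>x y. if x = y then 1 else 0)"
| "fun_mat_pow V M (Suc k) = (\<lambda>x y. \<Sum>z\<in>V. fun_mat_pow V M k x z * M z y)"

definition trace_pow :: "'a set \<Rightarrow> ('a \<Rightarrow> 'a \<Rightarrow> real) \<Rightarrow> nat \<Rightarrow> real" where
  "trace_pow V M k = (\<Sum>x\<in>V. fun_mat_pow V M k x x)"

definition Qmat :: "'a rel \<Rightarrow> 'a \<Rightarrow> 'a \<Rightarrow> real" where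
  "Qmat E x y = (if x = y then real (card (E `` {x})) else 0) + (if (x, y) \<in> E then 1 else 0)"

lemma Qmat_sym: "sym E \<Longrightarrow> Qmat E x y = Qmat E y x"
  by (auto simp: Qmat_def dest: symD)

lemma SLEE_sums_trace_pow:
  assumes fin: "finite (pverts G)" and E: "parcs G \<subseteq> pverts G \<times> pverts G" and sym: "sym (parcs G)"
  shows "(\<lambda>k. trace_pow (pverts G) (Qmat (parcs G)) k / fact k) sums SLEE G"
proof -
  define xs where "xs = vertex_list G"
  define n where "n = length xs"
  have xs: "distinct xs" "set xs = pverts G"
    using someI_ex[of "\<lambda>xs. distinct xs \<and> set xs = pverts G"] finite_distinct_list[OF fin]
    unfolding xs_def vertex_list_def by blast+
  have bij: "bij_betw ((!) xs) {..<n} (pverts G)"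
    using bij_betw_nth[OF xs(1)] xs(2) n_def by blast
  define A where "A = signless_laplacian G xs"
  have A: "A \<in> carrier_mat n n"
    by (auto simp: A_def n_def signless_laplacian_def degree_matrix_def adjacency_matrix_def)
  have deg: "out_degree (with_proj G) x = card (parcs G `` {x})" for x
  proof -
    have "bij_betw snd (out_arcs (with_proj G) x) (parcs G `` {x})"
      by (auto simp: bij_betw_def inj_on_def out_arcs_def image_iff)
    then show ?thesis by (simp add: out_degree_def bij_betw_same_card)
  qed
  have entry: "A $$ (i, j) = Qmat (parcs G) (xs ! i) (xs ! j)" if "i < n" "j < n" for i j
    using that nth_eq_iff_index_eq[OF xs(1)]
    by (auto simp: A_def n_def signless_laplacian_def degree_matrix_def adjacency_matrix_def Qmat_def deg)
  have pow: "(A ^\<^sub>m k) $$ (i, j) = fun_mat_pow (pverts G) (Qmat (parcs G)) k (xs ! i) (xs ! j)"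
    if "i < n" "j < n" for i j k
    using that
  proof (induction k arbitrary: j)
    case 0
    then show ?case using A nth_eq_iff_index_eq[OF xs(1)] by (auto simp: n_def)
  next
    case (Suc k)
    have "A ^\<^sub>m k \<in> carrier_mat n n" using A by simp
    then have "(A ^\<^sub>m Suc k) $$ (i, j) = (\<Sum>l<n. (A ^\<^sub>m k) $$ (i, l) * A $$ (l, j))"
      using A Suc.prems by (simp add: scalar_prod_def atLeast0LessThan)
    also have "\<dots> = (\<Sum>l<n. fun_mat_pow (pverts G) (Qmat (parcs G)) k (xs ! i) (xs ! l)
        * Qmat (parcs G) (xs ! l) (xs ! j))"
      using Suc by (simp add: entry)
    also have "\<dots> = fun_mat_pow (pverts G) (Qmat (parcs G)) (Suc k) (xs ! i) (xs ! j)"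
      using sum.reindex_bij_betw[OF bij] by simp
    finally show ?case .
  qed
  have "(\<Sum>i<n. (A ^\<^sub>m k) $$ (i, i)) = trace_pow (pverts G) (Qmat (parcs G)) k" for k
    using sum.reindex_bij_betw[OF bij, of "\<lambda>x. fun_mat_pow (pverts G) (Qmat (parcs G)) k x x"]
    by (simp add: trace_pow_def pow)
  moreover have "SLEE G = (\<Sum>q\<in>#proots (char_poly A). exp q)"
    by (simp add: SLEE_def A_def xs_def)
  ultimately show ?thesis
    using sum_exp_proots_char_poly[OF A] by (simp add: entry Qmat_sym[OF sym])
qed

definition fmult :: "'a set \<Rightarrow> ('a \<Rightarrow> 'a \<Rightarrow> real) \<Rightarrow> ('a \<Rightarrow> 'a \<Rightarrow> real) \<Rightarrow> 'a \<Rightarrow> 'a \<Rightarrow> real" where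
  "fmult V A B = (\<lambda>x y. \<Sum>z\<in>V. A x z * B z y)"

lemma fmult_assoc: "fmult V (fmult V A B) C = fmult V A (fmult V B C)"
proof (intro ext)
  fix x y
  have "fmult V (fmult V A B) C x y = (\<Sum>z\<in>V. \<Sum>w\<in>V. A x w * B w z * C z y)"
    by (simp add: fmult_def sum_distrib_right)
  also have "\<dots> = (\<Sum>w\<in>V. \<Sum>z\<in>V. A x w * B w z * C z y)" by (rule sum.swap)
  also have "\<dots> = fmult V A (fmult V B C) x y"
    by (simp add: fmult_def sum_distrib_left mult.assoc)
  finally show "fmult V (fmult V A B) C x y = fmult V A (fmult V B C) x y" .
qed

text \<open>
  \<open>R\<close> is its own inverse on \<open>V\<close>, so \<open>N = R M R\<close> is similar to
  \<open>M\<close>.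
\<close>

lemma trace_pow_conjugate:
  assumes fin: "finite V"
    and R: "\<And>x y. x \<in> V \<Longrightarrow> y \<in> V \<Longrightarrow> fmult V R R x y = (if x = y then 1 else 0)"
    and N: "\<And>x y. x \<in> V \<Longrightarrow> y \<in> V \<Longrightarrow> N x y = fmult V R (fmult V M R) x y"
  shows "trace_pow V N k = trace_pow V M k"
proof -
  have RR: "fmult V (fmult V R R) A x y = A x y" if "x \<in> V" for A x y
  proof -
    have "fmult V (fmult V R R) A x y = (\<Sum>z\<in>V. (if x = z then 1 else 0) * A z y)"
      unfolding fmult_def[of V "fmult V R R"] using R that by (intro sum.cong) auto
    also have "\<dots> = (\<Sum>z\<in>V. if x = z then A z y else 0)" by (intro sum.cong) auto
    also have "\<dots> = A x y" using fin that by simp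
    finally show ?thesis .
  qed
  have RR': "fmult V A (fmult V R R) x y = A x y" if "y \<in> V" for A x y
  proof -
    have "fmult V A (fmult V R R) x y = (\<Sum>z\<in>V. A x z * (if z = y then 1 else 0))"
      unfolding fmult_def[of V A "fmult V R R"] using R that by (intro sum.cong) auto
    also have "\<dots> = (\<Sum>z\<in>V. if z = y then A x z else 0)" by (intro sum.cong) auto
    also have "\<dots> = A x y" using fin that by simp
    finally show ?thesis .
  qed
  have P: "fun_mat_pow V N k x y = fmult V R (fmult V (fun_mat_pow V M k) R) x y" if "x \<in> V" "y \<in> V" for x y k
    using that
  proof (induction k arbitrary: y)
    case 0
    have "fmult V (fun_mat_pow V M 0) R z y = R z y" if "z \<in> V" for z
    proof -
      have "fmult V (fun_mat_pow V M 0) R z y = (\<Sum>w\<in>V. if z = w then R w y else 0)"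
        unfolding fmult_def by (intro sum.cong) auto
      then show ?thesis using fin that by simp
    qed
    then have "fmult V R (fmult V (fun_mat_pow V M 0) R) x y = fmult V R R x y"
      unfolding fmult_def[of V R] by (intro sum.cong) auto
    then show ?case using R 0 by simp
  next
    case (Suc k)
    let ?P = "fun_mat_pow V M k"
    have "fun_mat_pow V N (Suc k) x y = (\<Sum>z\<in>V. fmult V R (fmult V ?P R) x z * fmult V R (fmult V M R) z y)"
      using Suc by (simp add: N)
    also have "\<dots> = fmult V (fmult V R (fmult V ?P R)) (fmult V R (fmult V M R)) x y"
      by (simp add: fmult_def)
    also have "\<dots> = fmult V (fmult V (fmult V R ?P) (fmult V R R)) (fmult V M R) x y"
      by (simp only: fmult_assoc)
    also have "\<dots> = fmult V (fmult V R ?P) (fmult V M R) x y"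
      unfolding fmult_def[of V _ "fmult V M R"] by (intro sum.cong refl) (simp add: RR')
    also have "\<dots> = fmult V R (fmult V (fmult V ?P M) R) x y"
      by (simp only: fmult_assoc)
    also have "fmult V ?P M = fun_mat_pow V M (Suc k)"
      by (simp add: fmult_def)
    finally show ?case .
  qed
  have "trace_pow V N k = (\<Sum>x\<in>V. \<Sum>z\<in>V. R x z * fmult V (fun_mat_pow V M k) R z x)"
    by (simp add: trace_pow_def P) (simp add: fmult_def)
  also have "\<dots> = (\<Sum>z\<in>V. \<Sum>x\<in>V. fmult V (fun_mat_pow V M k) R z x * R x z)"
    by (subst sum.swap) (simp add: mult.commute)
  also have "\<dots> = (\<Sum>z\<in>V. fmult V (fmult V (fun_mat_pow V M k) R) R z z)"
    by (simp add: fmult_def)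
  also have "\<dots> = trace_pow V M k"
    unfolding trace_pow_def fmult_assoc by (intro sum.cong refl) (simp add: RR')
  finally show ?thesis .
qed

lemma trace_pow_mono:
  assumes "\<And>x y. x \<in> V \<Longrightarrow> y \<in> V \<Longrightarrow> \<bar>N x y\<bar> \<le> N' x y"
  shows "trace_pow V N k \<le> trace_pow V N' k"
proof -
  have "\<bar>fun_mat_pow V N k x y\<bar> \<le> fun_mat_pow V N' k x y" if "x \<in> V" "y \<in> V" for x y
    using that
  proof (induction k arbitrary: y)
    case (Suc k)
    have "\<bar>fun_mat_pow V N (Suc k) x y\<bar> \<le> (\<Sum>z\<in>V. \<bar>fun_mat_pow V N k x z\<bar> * \<bar>N z y\<bar>)"
      by (simp add: sum_abs[THEN order_trans] abs_mult flip: abs_mult)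
    also have "\<dots> \<le> fun_mat_pow V N' (Suc k) x y"
      using Suc assms by (auto intro!: sum_mono mult_mono)
        (meson abs_ge_zero order_trans)
    finally show ?case .
  qed auto
  then show ?thesis unfolding trace_pow_def by (intro sum_mono) (meson abs_le_D1)
qed

text \<open>
  Up to positive factors, the entries of \<open>M\<close> in the basis of symmetric and antisymmetric
  vectors of the involution \<open>\<tau>\<close>. A pair \<open>x, \<tau> x\<close> with \<open>s x =
  1\<close> stores \<open>e\<^sub>x + e\<^sub>\<tau>\<^sub>x\<close> at index \<open>x\<close> and
  \<open>e\<^sub>x - e\<^sub>\<tau>\<^sub>x\<close> at index \<open>\<tau> x\<close>.
\<close>

definition reflect :: "('a \<Rightarrow> 'a) \<Rightarrow> ('a \<Rightarrow> real) \<Rightarrow> ('a \<Rightarrow> 'a \<Rightarrow> real) \<Rightarrow> 'a \<Rightarrow> 'a \<Rightarrow> real" where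
  "reflect \<tau> s M x y = M (\<tau> x) (\<tau> y) + s y * M (\<tau> x) y + s x * M x (\<tau> y) + s x * s y * M x y"

definition signed_involution :: "'a set \<Rightarrow> ('a \<Rightarrow> 'a) \<Rightarrow> ('a \<Rightarrow> real) \<Rightarrow> bool" where
  "signed_involution V \<tau> s \<longleftrightarrow> (\<forall>x. \<tau> (\<tau> x) = x) \<and> \<tau> ` V \<subseteq> V \<and>
     (\<forall>x. s x = 1 \<or> s x = -1) \<and> (\<forall>x. s (\<tau> x) = (if \<tau> x = x then 1 else - s x))"

text \<open>
  The change of basis is the symmetric orthogonal matrix \<open>R\<close> with \<open>R x y = c x ([y =
  \<tau> x] + s x [y = x])\<close>, where \<open>c\<close> normalises the basis vectors. Conjugation
  with \<open>R\<close> keeps the traces of powers, and \<open>reflect\<close> is the conjugated matrix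
  up to the positive factors \<open>c x c y\<close>, so entrywise domination applies.
\<close>

lemma trace_pow_reflect_mono:
  assumes fin: "finite V" and inv: "signed_involution V \<tau> s"
    and dom: "\<And>x y. x \<in> V \<Longrightarrow> y \<in> V \<Longrightarrow> \<bar>reflect \<tau> s M x y\<bar> \<le> reflect \<tau> s M' x y"
  shows "trace_pow V M k \<le> trace_pow V M' k"
proof -
  define c :: "'a \<Rightarrow> real" where "c x = (if \<tau> x = x then 1/2 else 1 / sqrt 2)" for x
  have tt: "\<tau> (\<tau> x) = x" and tV: "x \<in> V \<Longrightarrow> \<tau> x \<in> V" and s2: "s x * s x = 1"
    and st: "s (\<tau> x) = (if \<tau> x = x then 1 else - s x)" for x
  proof -
    have "s x = 1 \<or> s x = -1" using inv by (simp add: signed_involution_def)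
    then show "s x * s x = 1" by auto
  qed (use inv in \<open>auto simp: signed_involution_def\<close>)
  have sfix: "s x = 1" if "\<tau> x = x" for x using st[of x] that by simp
  have ct: "c (\<tau> x) = c x" for x by (auto simp: c_def tt)
  have cpos: "c x > 0" for x by (simp add: c_def)
  define R where "R x y = c x * ((if y = \<tau> x then 1 else 0) + s x * (if y = x then 1 else 0))" for x y
  have Rsym: "R x y = R y x" for x y
    using tt[of x] tt[of y] ct[of x] ct[of y] by (auto simp: R_def)
  have left: "fmult V R A x y = c x * (A (\<tau> x) y + s x * A x y)" if "x \<in> V" for A x y
  proof -
    have "fmult V R A x y = c x * ((\<Sum>z\<in>V. if z = \<tau> x then A z y else 0) + s x * (\<Sum>z\<in>V. if z = x then A z y else 0))"
      unfolding fmult_def R_def sum_distrib_left sum.distrib[symmetric]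
      by (intro sum.cong refl) (auto simp: algebra_simps)
    then show ?thesis using fin that tV by simp
  qed
  have right: "fmult V A R x y = c y * (A x (\<tau> y) + s y * A x y)" if "y \<in> V" for A x y
  proof -
    have "fmult V A R x y = c y * ((\<Sum>z\<in>V. if z = \<tau> y then A x z else 0) + s y * (\<Sum>z\<in>V. if z = y then A x z else 0))"
      unfolding fmult_def Rsym[of _ y] unfolding R_def sum_distrib_left sum.distrib[symmetric]
      by (intro sum.cong refl) (auto simp: algebra_simps)
    then show ?thesis using fin that tV by simp
  qed
  have RR: "fmult V R R x y = (if x = y then 1 else 0)" if "x \<in> V" "y \<in> V" for x y
  proof (cases "\<tau> x = x")
    case True
    then show ?thesis using left[OF that(1)] sfix[of x] by (auto simp: R_def c_def)
  next
    case False
    then have "\<tau> (\<tau> x) \<noteq> \<tau> x" by (simp add: tt)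
    then show ?thesis
      using False left[OF that(1), of R y] st[of x] s2[of x]
      by (auto simp: R_def c_def tt algebra_simps)
  qed
  have conj: "fmult V R (fmult V A R) x y = c x * c y * reflect \<tau> s A x y" if "x \<in> V" "y \<in> V" for A x y
    using that by (simp add: left right tV reflect_def algebra_simps)
  have "trace_pow V M k = trace_pow V (\<lambda>x y. c x * c y * reflect \<tau> s M x y) k"
    by (rule trace_pow_conjugate[symmetric, OF fin RR]) (simp_all add: conj)
  also have "\<dots> \<le> trace_pow V (\<lambda>x y. c x * c y * reflect \<tau> s M' x y) k"
    by (rule trace_pow_mono) (use dom cpos in \<open>simp add: abs_mult less_imp_le mult_left_mono\<close>)
  also have "\<dots> = trace_pow V M' k"
    by (rule trace_pow_conjugate[OF fin RR]) (simp_all add: conj)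
  finally show ?thesis .
qed

section \<open>Moving neighbours from one vertex to another\<close>

definition sgraph :: "'a set \<Rightarrow> 'a rel \<Rightarrow> bool" where
  "sgraph V E \<longleftrightarrow> finite V \<and> E \<subseteq> V \<times> V \<and> sym E \<and> irrefl E"

abbreviation deg :: "'a rel \<Rightarrow> 'a \<Rightarrow> nat" where
  "deg E x \<equiv> card (E `` {x})"

abbreviation slee :: "'a set \<Rightarrow> 'a rel \<Rightarrow> real" where
  "slee V E \<equiv> SLEE \<lparr>pverts = V, parcs = E\<rparr>"

lemma sgraph_finite: "sgraph V E \<Longrightarrow> finite E"
  by (auto simp: sgraph_def intro: finite_subset)

lemma sgraph_finite_nbrs: "sgraph V E \<Longrightarrow> finite (E `` A)"
  using sgraph_finite by (metis finite_Image)

lemma sgraph_sym: "sgraph V E \<Longrightarrow> (x, y) \<in> E \<Longrightarrow> (y, x) \<in> E"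
  by (auto simp: sgraph_def dest: symD)

lemma sgraph_neq: "sgraph V E \<Longrightarrow> (x, y) \<in> E \<Longrightarrow> x \<noteq> y"
  by (auto simp: sgraph_def irrefl_def)

lemma sgraph_mem: "sgraph V E \<Longrightarrow> (x, y) \<in> E \<Longrightarrow> x \<in> V \<and> y \<in> V"
  by (auto simp: sgraph_def)

lemma slee_sums: "sgraph V E \<Longrightarrow> (\<lambda>k. trace_pow V (Qmat E) k / fact k) sums slee V E"
  using SLEE_sums_trace_pow[of "\<lparr>pverts = V, parcs = E\<rparr>"] by (simp add: sgraph_def)

lemma slee_less:
  assumes G: "sgraph V E" and G': "sgraph V' E'"
    and le: "\<And>k. trace_pow V (Qmat E) k \<le> trace_pow V' (Qmat E') k"
    and less: "trace_pow V (Qmat E) m < trace_pow V' (Qmat E') m"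
  shows "slee V E < slee V' E'"
proof -
  let ?f = "\<lambda>k. trace_pow V' (Qmat E') k / fact k - trace_pow V (Qmat E) k / fact k"
  have f: "?f sums (slee V' E' - slee V E)"
    using sums_diff[OF slee_sums[OF G'] slee_sums[OF G]] .
  have "0 < suminf ?f"
    by (rule suminf_pos2[of _ m]) (use f le less in \<open>auto simp: sums_iff divide_right_mono divide_strict_right_mono\<close>)
  then show ?thesis using f by (simp add: sums_iff)
qed

lemma trace_pow_2:
  assumes G: "sgraph V E"
  shows "trace_pow V (Qmat E) 2 = (\<Sum>x\<in>V. (real (deg E x))\<^sup>2) + real (card E)"
proof -
  have fin: "finite V" and irr: "\<And>x. (x, x) \<notin> E" and EV: "E \<subseteq> V \<times> V"
    using G by (auto simp: sgraph_def irrefl_def)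
  have sq: "Qmat E x z * Qmat E z x = (if z = x then (real (deg E x))\<^sup>2 else 0) + (if (x, z) \<in> E then 1 else 0)" for x z
    using irr sgraph_sym[OF G] by (auto simp: Qmat_def power2_eq_square)
  have inner: "(\<Sum>z\<in>V. if (x, z) \<in> E then 1 else (0 :: real)) = real (deg E x)" for x
  proof -
    have "V \<inter> {z. (x, z) \<in> E} = E `` {x}" using EV by auto
    then show ?thesis using fin by (simp add: sum.If_cases)
  qed
  have "E = Sigma V (\<lambda>x. E `` {x})" using EV by auto
  then have cardE: "card E = (\<Sum>x\<in>V. deg E x)"
    using fin sgraph_finite_nbrs[OF G] by (metis card_SigmaI)
  have one: "fun_mat_pow V M (Suc 0) x z = M x z" if "x \<in> V" for M x and z :: 'a
  proof -
    have "fun_mat_pow V M (Suc 0) x z = (\<Sum>w\<in>V. if x = w then M w z else 0)"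
      by (simp, intro sum.cong) auto
    then show ?thesis using fin that by simp
  qed
  have "trace_pow V (Qmat E) 2 = (\<Sum>x\<in>V. \<Sum>z\<in>V. Qmat E x z * Qmat E z x)"
    unfolding trace_pow_def numeral_2_eq_2 fun_mat_pow.simps(2)[of _ _ "Suc 0"]
    by (intro sum.cong refl) (simp only: one)
  also have "\<dots> = (\<Sum>x\<in>V. (real (deg E x))\<^sup>2 + real (deg E x))"
    using fin by (intro sum.cong refl) (simp add: sq sum.distrib inner)
  finally show ?thesis by (simp add: cardE sum.distrib)
qed

definition ind :: "'a \<Rightarrow> 'a \<Rightarrow> real" where "ind p x = (if x = p then 1 else 0)"

text \<open>
  The decomposition of \<open>Q\<close> into the rank-one matrices \<open>b b\<^sup>T\<close> with
  \<open>b = e\<^sub>p + e\<^sub>q\<close>, one for each edge. The sum ranges over arcs and so meets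
  every edge twice.
\<close>

lemma Qmat_edge_sum:
  assumes G: "sgraph V E"
  shows "2 * Qmat E x y = (\<Sum>(p, q)\<in>E. (ind p x + ind q x) * (ind p y + ind q y))"
proof -
  have fin: "finite E" by (rule sgraph_finite[OF G])
  have d1: "(\<Sum>(p, q)\<in>E. ind p x * ind p y) = (if x = y then real (deg E x) else 0)" for x y
  proof (cases "x = y")
    case True
    have "(\<Sum>(p, q)\<in>E. ind p x * ind p y) = (\<Sum>e\<in>E. if fst e = x then 1 else 0)"
      using True by (intro sum.cong) (auto simp: ind_def)
    also have "\<dots> = real (card (E \<inter> {e. fst e = x}))" using fin by (simp add: sum.If_cases)
    also have "E \<inter> {e. fst e = x} = Pair x ` (E `` {x})" by auto
    also have "card \<dots> = deg E x" by (rule card_image) (auto simp: inj_on_def)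
    finally show ?thesis using True by simp
  next
    case False
    then have "(\<Sum>(p, q)\<in>E. ind p x * ind p y) = (\<Sum>e\<in>E. 0)"
      by (intro sum.cong) (auto simp: ind_def)
    then show ?thesis using False by simp
  qed
  have m1: "(\<Sum>(p, q)\<in>E. ind p x * ind q y) = (if (x, y) \<in> E then 1 else 0)" for x y
  proof -
    have "(\<Sum>(p, q)\<in>E. ind p x * ind q y) = (\<Sum>e\<in>E. if e = (x, y) then 1 else 0)"
      by (intro sum.cong) (auto simp: ind_def split: if_splits)
    then show ?thesis using fin by simp
  qed
  have flip: "(\<Sum>(p, q)\<in>E. f p q) = (\<Sum>(p, q)\<in>E. f q p)" for f :: "'a \<Rightarrow> 'a \<Rightarrow> real"
  proof -
    have "prod.swap ` E = E" using sgraph_sym[OF G] by (auto simp: image_iff) (metis swap_simp)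
    then have "(\<Sum>(p, q)\<in>E. f p q) = (\<Sum>(p, q)\<in>prod.swap ` E. f p q)" by simp
    also have "\<dots> = (\<Sum>(p, q)\<in>E. f q p)"
      by (subst sum.reindex) (auto simp: inj_on_def case_prod_unfold)
    finally show ?thesis .
  qed
  have d2: "(\<Sum>(p, q)\<in>E. ind q x * ind q y) = (if x = y then real (deg E x) else 0)"
    using d1[of x y] by (subst flip) simp
  have m2: "(\<Sum>(p, q)\<in>E. ind q x * ind p y) = (if (x, y) \<in> E then 1 else 0)"
    using m1[of x y] by (subst flip) simp
  have "(\<Sum>(p, q)\<in>E. (ind p x + ind q x) * (ind p y + ind q y))
    = (\<Sum>(p, q)\<in>E. ind p x * ind p y) + (\<Sum>(p, q)\<in>E. ind p x * ind q y)
      + (\<Sum>(p, q)\<in>E. ind q x * ind p y) + (\<Sum>(p, q)\<in>E. ind q x * ind q y)"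
    by (simp add: case_prod_unfold algebra_simps sum.distrib)
  then show ?thesis by (simp add: d1 d2 m1 m2 Qmat_def)
qed

definition shift :: "'a \<Rightarrow> 'a \<Rightarrow> 'a set \<Rightarrow> 'a rel \<Rightarrow> 'a rel" where
  "shift u v S E = (E - ({v} \<times> S \<union> S \<times> {v})) \<union> ({u} \<times> S \<union> S \<times> {u})"

lemma sgraph_shift:
  assumes G: "sgraph V E" and "u \<in> V" "S \<subseteq> E `` {v}" "u \<notin> S"
  shows "sgraph V (shift u v S E)"
  using assms unfolding sgraph_def shift_def irrefl_def sym_def by blast

lemma shift_nbrs:
  assumes G: "sgraph V E" and S: "S \<subseteq> E `` {v}" "u \<notin> S" and uv: "u \<noteq> v"
  shows "shift u v S E `` {u} = E `` {u} \<union> S"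
    and "shift u v S E `` {v} = E `` {v} - S"
    and "x \<noteq> u \<Longrightarrow> x \<noteq> v \<Longrightarrow> shift u v S E `` {x} = (if x \<in> S then insert u (E `` {x} - {v}) else E `` {x})"
  using assms sgraph_neq[OF G] unfolding shift_def by auto

lemma shift_deg:
  assumes G: "sgraph V E" and S: "S \<subseteq> E `` {v} - E `` {u}" "u \<notin> S" and uv: "u \<noteq> v"
  shows "deg (shift u v S E) u = deg E u + card S"
    and "deg (shift u v S E) v = deg E v - card S"
    and "x \<noteq> u \<Longrightarrow> x \<noteq> v \<Longrightarrow> deg (shift u v S E) x = deg E x"
proof -
  have S': "S \<subseteq> E `` {v}" using S by auto
  note n = shift_nbrs[OF G S' S(2) uv]
  have fin: "finite (E `` A)" for A by (rule sgraph_finite_nbrs[OF G])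
  have finS: "finite S" using S' fin finite_subset by blast
  show "deg (shift u v S E) u = deg E u + card S"
    unfolding n(1) using fin finS S by (intro card_Un_disjoint) auto
  show "deg (shift u v S E) v = deg E v - card S"
    unfolding n(2) using finS S' by (rule card_Diff_subset)
  show "deg (shift u v S E) x = deg E x" if "x \<noteq> u" "x \<noteq> v"
  proof (cases "x \<in> S")
    case True
    then have "v \<in> E `` {x}" "u \<notin> E `` {x}" using S sgraph_sym[OF G] by auto
    then have "card (insert u (E `` {x} - {v})) = Suc (card (E `` {x} - {v}))"
      using fin by (intro card_insert_disjoint) auto
    also have "\<dots> = deg E x" using fin \<open>v \<in> E `` {x}\<close> by (rule card_Suc_Diff1)
    finally show ?thesis using True n(3)[OF that] by simp
  qed (simp add: n(3)[OF that])
qed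

lemma card_shift:
  assumes G: "sgraph V E" and S: "S \<subseteq> E `` {v} - E `` {u}" "u \<notin> S"
  shows "card (shift u v S E) = card E"
proof -
  have fin: "finite E" by (rule sgraph_finite[OF G])
  have finS: "finite S" using S sgraph_finite_nbrs[OF G] finite_subset by (metis Diff_subset order_trans)
  have vS: "v \<notin> S" using S sgraph_neq[OF G] by blast
  have two: "card ({w} \<times> S \<union> S \<times> {w}) = 2 * card S" if "w \<notin> S" for w
    using that finS by (subst card_Un_disjoint) (auto simp: card_cartesian_product)
  have sub: "{v} \<times> S \<union> S \<times> {v} \<subseteq> E" using S sgraph_sym[OF G] by auto
  have "card (shift u v S E) = card (E - ({v} \<times> S \<union> S \<times> {v})) + 2 * card S"
    unfolding shift_def two[OF S(2), symmetric]
    by (rule card_Un_disjoint) (use fin finS S sgraph_sym[OF G] in auto)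
  also have "card (E - ({v} \<times> S \<union> S \<times> {v})) = card E - 2 * card S"
    using sub finS two[OF vS] by (subst card_Diff_subset) auto
  finally show ?thesis using card_mono[OF fin sub] two[OF vS] by simp
qed

text \<open>
  The sign \<open>s x = -1\<close> marks the side of \<open>v\<close>. In the reflected basis the arc
  \<open>e = (p, q)\<close> contributes \<open>g e x * g e y\<close>, where \<open>g e = R (e\<^sub>p +
  e\<^sub>q)\<close> up to scaling, and its mirror image has \<open>g (\<tau> e) x = s x * g e
  x\<close>. Arcs away from the side of \<open>v\<close> and arcs \<open>(x, \<tau> x)\<close> have
  nonnegative \<open>g\<close>. The last hypothesis says that every other arc that stays has its mirror
  image in the graph, which outweighs its negative entries. The moved arcs are replaced by their mirror
  images, that is, by the absolute values of their contributions.
\<close>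

lemma trace_pow_shift:
  assumes G: "sgraph V E" and uV: "u \<in> V" and uv: "u \<noteq> v"
    and S: "S \<subseteq> E `` {v} - E `` {u}" "u \<notin> S"
    and inv: "signed_involution V \<tau> s" and tv: "\<tau> v = u" and su: "s u = 1"
    and tS: "\<And>w. w \<in> S \<Longrightarrow> \<tau> w = w"
    and arcs: "\<And>x y. (x, y) \<in> E - ({v} \<times> S \<union> S \<times> {v}) \<Longrightarrow>
      (s x = 1 \<and> s y = 1) \<or> y = \<tau> x \<or> (s (\<tau> x) = 1 \<and> s (\<tau> y) = 1 \<and> (\<tau> x, \<tau> y) \<in> E)"
  shows "trace_pow V (Qmat E) k \<le> trace_pow V (Qmat (shift u v S E)) k"
proof (rule trace_pow_reflect_mono[OF _ inv])
  show "finite V" using G by (simp add: sgraph_def)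
  fix x y assume "x \<in> V" "y \<in> V"
  have S': "S \<subseteq> E `` {v}" using S by auto
  have G': "sgraph V (shift u v S E)" by (rule sgraph_shift[OF G uV S' S(2)])
  have tt: "\<tau> (\<tau> x) = x" and sv: "s x = 1 \<or> s x = -1"
    and st: "s (\<tau> x) = (if \<tau> x = x then 1 else - s x)" for x
    using inv by (auto simp: signed_involution_def)
  have s2: "s x * s x = 1" and sabs: "\<bar>s x\<bar> = 1" for x using sv[of x] by auto
  have sv1: "s v = -1" using st[of v] tv uv su by auto
  define h where "h p x = ind p (\<tau> x) + s x * ind p x" for p x
  define g where "g e x = h (fst e) x + h (snd e) x" for e x
  define T where "T = map_prod \<tau> \<tau>"
  have injT: "inj_on T A" for A
    by (auto simp: inj_on_def T_def) (metis tt)+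
  have gT: "g (T e) x = s x * g e x" for e x
  proof -
    have "h (\<tau> p) x = s x * h p x" for p
      unfolding h_def ind_def using s2[of x] tt by (auto simp: distrib_left) (metis tt)+
    then show ?thesis by (simp add: g_def T_def distrib_left)
  qed
  have gTabs: "\<bar>g (T e) x\<bar> = \<bar>g e x\<bar>" for e x by (simp add: gT abs_mult sabs)
  have hpos: "h p x \<ge> 0" if "s p = 1" for p x
    using that sv[of x] by (auto simp: h_def ind_def)
  have gpos: "g e x \<ge> 0" if "s (fst e) = 1" "s (snd e) = 1" for e x
    using that hpos by (simp add: g_def)
  have gpos': "g (p, \<tau> p) x \<ge> 0" for p x
    unfolding g_def h_def ind_def using sv[of x] tt by auto
  have refl_sum: "2 * reflect \<tau> s (Qmat F) x y = (\<Sum>e\<in>F. g e x * g e y)" if "sgraph V F" for F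
  proof -
    have "2 * reflect \<tau> s (Qmat F) x y = 2 * Qmat F (\<tau> x) (\<tau> y) + s y * (2 * Qmat F (\<tau> x) y)
      + s x * (2 * Qmat F x (\<tau> y)) + s x * s y * (2 * Qmat F x y)"
      by (simp add: reflect_def algebra_simps)
    also have "\<dots> = (\<Sum>e\<in>F. g e x * g e y)"
      unfolding Qmat_edge_sum[OF that] sum_distrib_left sum.distrib[symmetric]
      by (intro sum.cong refl) (simp add: case_prod_unfold g_def h_def algebra_simps)
    finally show ?thesis .
  qed
  define D where "D = {v} \<times> S \<union> S \<times> {v}"
  define K where "K = E - D"
  have finE: "finite E" by (rule sgraph_finite[OF G])
  have DE: "D \<subseteq> E" using S sgraph_sym[OF G] by (auto simp: D_def)
  have finK: "finite K" and finD: "finite D" using finE DE finite_subset by (auto simp: K_def)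
  have TD: "T ` D = {u} \<times> S \<union> S \<times> {u}"
    using tv tS by (force simp: T_def D_def image_iff)
  have shift: "shift u v S E = K \<union> T ` D" unfolding TD by (simp add: shift_def K_def D_def)
  have disj: "K \<inter> T ` D = {}" unfolding TD K_def using S sgraph_sym[OF G] by auto
  have sS: "s w = 1" if "w \<in> S" for w using st[of w] tS[OF that] by simp
  have posD: "g e x \<ge> 0" if "e \<in> T ` D" for e x
    using that su sS unfolding TD by (intro gpos) auto
  have sumE: "(\<Sum>e\<in>E. g e x * g e y) = (\<Sum>e\<in>K. g e x * g e y) + (\<Sum>e\<in>D. g e x * g e y)"
    using sum.subset_diff[OF DE finE] by (simp add: K_def)
  have sumE': "(\<Sum>e\<in>shift u v S E. g e x * g e y) = (\<Sum>e\<in>K. g e x * g e y) + (\<Sum>e\<in>T ` D. g e x * g e y)"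
    unfolding shift by (rule sum.union_disjoint) (use finK finD disj in auto)
  have refl_le: "\<bar>\<Sum>e\<in>A. g e x * g e y\<bar> \<le> (\<Sum>e\<in>T ` A. g e x * g e y)" if "\<And>e x. e \<in> T ` A \<Longrightarrow> g e x \<ge> 0" for A
  proof -
    have "\<bar>\<Sum>e\<in>A. g e x * g e y\<bar> \<le> (\<Sum>e\<in>A. \<bar>g e x\<bar> * \<bar>g e y\<bar>)"
      using sum_abs[of "\<lambda>e. g e x * g e y" A] by (simp add: abs_mult)
    also have "\<dots> = (\<Sum>e\<in>A. g (T e) x * g (T e) y)"
    proof (rule sum.cong[OF refl])
      fix e assume "e \<in> A"
      then have "\<bar>g e z\<bar> = g (T e) z" for z using that[of "T e" z] gTabs[of e z] by simp
      then show "\<bar>g e x\<bar> * \<bar>g e y\<bar> = g (T e) x * g (T e) y" by simp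
    qed
    also have "\<dots> = (\<Sum>e\<in>T ` A. g e x * g e y)" by (simp add: sum.reindex[OF injT])
    finally show ?thesis .
  qed
  \<comment> \<open>The arcs with nonnegative contribution; mirroring maps the other remaining arcs into them.\<close>
  define U where "U = {e \<in> K. \<forall>x. g e x \<ge> 0}"
  have LU: "T ` (K - U) \<subseteq> U"
  proof
    fix e' assume "e' \<in> T ` (K - U)"
    then obtain p q where pq: "(p, q) \<in> K" "(p, q) \<notin> U" "e' = (\<tau> p, \<tau> q)" by (auto simp: T_def)
    then have "\<not> (s p = 1 \<and> s q = 1)" "q \<noteq> \<tau> p"
      using gpos[of "(p, q)"] gpos'[of p] by (auto simp: U_def)
    then have *: "s (\<tau> p) = 1" "s (\<tau> q) = 1" "(\<tau> p, \<tau> q) \<in> E"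
      using arcs[of p q] pq(1) by (auto simp: K_def D_def)
    then have "e' \<in> K" unfolding K_def D_def pq(3) using sv1 by auto
    then show "e' \<in> U" using * gpos[of e'] by (auto simp: U_def pq(3))
  qed
  have "0 \<le> (\<Sum>e\<in>K. g e x * g e y)"
  proof -
    have "\<bar>\<Sum>e\<in>K - U. g e x * g e y\<bar> \<le> (\<Sum>e\<in>T ` (K - U). g e x * g e y)"
      by (rule refl_le) (use LU in \<open>auto simp: U_def\<close>)
    also have "\<dots> \<le> (\<Sum>e\<in>U. g e x * g e y)"
      by (rule sum_mono2[OF _ LU]) (use finK in \<open>auto simp: U_def\<close>)
    finally show ?thesis
      using sum.subset_diff[of U K "\<lambda>e. g e x * g e y"] finK by (auto simp: U_def)
  qed
  moreover have "\<bar>\<Sum>e\<in>D. g e x * g e y\<bar> \<le> (\<Sum>e\<in>T ` D. g e x * g e y)"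
    by (rule refl_le) (rule posD)
  ultimately show "\<bar>reflect \<tau> s (Qmat E) x y\<bar> \<le> reflect \<tau> s (Qmat (shift u v S E)) x y"
    using refl_sum[OF G] refl_sum[OF G'] sumE sumE' by linarith
qed

text \<open>
  The trace of \<open>Q\<^sup>2\<close> gains \<open>2 t (d u + t - d v)\<close> for \<open>t = card
  S\<close>.
\<close>

lemma slee_shift_less:
  assumes G: "sgraph V E" and uV: "u \<in> V" and uv: "u \<noteq> v"
    and S: "S \<subseteq> E `` {v} - E `` {u}" "u \<notin> S" "S \<noteq> {}"
    and inv: "signed_involution V \<tau> s" and tv: "\<tau> v = u" and su: "s u = 1"
    and tS: "\<And>w. w \<in> S \<Longrightarrow> \<tau> w = w"
    and arcs: "\<And>x y. (x, y) \<in> E - ({v} \<times> S \<union> S \<times> {v}) \<Longrightarrow>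
      (s x = 1 \<and> s y = 1) \<or> y = \<tau> x \<or> (s (\<tau> x) = 1 \<and> s (\<tau> y) = 1 \<and> (\<tau> x, \<tau> y) \<in> E)"
    and deg: "deg E v < deg E u + card S"
  shows "slee V E < slee V (shift u v S E)"
proof (rule slee_less[OF G])
  have S': "S \<subseteq> E `` {v}" using S by auto
  show G': "sgraph V (shift u v S E)" by (rule sgraph_shift[OF G uV S' S(2)])
  show "trace_pow V (Qmat E) k \<le> trace_pow V (Qmat (shift u v S E)) k" for k
    by (rule trace_pow_shift[OF G uV uv S(1,2) inv tv su tS arcs])
  have vV: "v \<in> V" using S sgraph_mem[OF G] by auto
  have fin: "finite V" using G by (simp add: sgraph_def)
  have finN: "finite (E `` A)" for A by (rule sgraph_finite_nbrs[OF G])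
  let ?E' = "shift u v S E"
  note d = shift_deg[OF G S(1,2) uv]
  have Sv: "card S \<le> deg E v" by (rule card_mono[OF finN S'])
  have S0: "card S > 0" using S(3) finite_subset[OF S' finN] by (simp add: card_gt_0_iff)
  have split: "(\<Sum>x\<in>V. f x) = f u + f v + (\<Sum>x\<in>V - {u, v}. f x)" for f :: "'a \<Rightarrow> real"
    using sum.subset_diff[of "{u, v}" V f] fin uV vV uv by simp
  have "(\<Sum>x\<in>V - {u, v}. (real (deg ?E' x))\<^sup>2) = (\<Sum>x\<in>V - {u, v}. (real (deg E x))\<^sup>2)"
    using d(3) by (intro sum.cong) auto
  moreover have "(real (deg E u))\<^sup>2 + (real (deg E v))\<^sup>2 < (real (deg ?E' u))\<^sup>2 + (real (deg ?E' v))\<^sup>2"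
  proof -
    define a b t where "a = real (deg E u)" and "b = real (deg E v)" and "t = real (card S)"
    have du: "real (deg ?E' u) = a + t" and dv: "real (deg ?E' v) = b - t"
      using d(1,2) Sv by (simp_all add: a_def b_def t_def)
    have "0 < t * (a + t - b)"
      using deg S0 by (intro mult_pos_pos) (simp_all add: a_def b_def t_def)
    then show ?thesis
      unfolding du dv unfolding a_def[symmetric] b_def[symmetric]
      by (simp add: power2_eq_square algebra_simps)
  qed
  ultimately have "(\<Sum>x\<in>V. (real (deg E x))\<^sup>2) < (\<Sum>x\<in>V. (real (deg ?E' x))\<^sup>2)"
    by (simp add: split)
  then show "trace_pow V (Qmat E) 2 < trace_pow V (Qmat ?E') 2"
    using card_shift[OF G S(1,2)] by (simp add: trace_pow_2[OF G] trace_pow_2[OF G'])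
qed

text \<open>
  The involution is the transposition \<open>(u v)\<close>. The neighbours of \<open>v\<close> that do
  not move are possibly \<open>u\<close> and the common neighbours, whose arcs from \<open>v\<close> are
  paired with arcs from \<open>u\<close>. A private neighbour of \<open>u\<close> yields the strict
  degree condition.
\<close>

lemma slee_kelmans_less:
  assumes G: "sgraph V E" and uV: "u \<in> V" and vV: "v \<in> V" and uv: "u \<noteq> v"
    and pv: "E `` {v} - E `` {u} - {u} \<noteq> {}" and pu: "E `` {u} - E `` {v} - {v} \<noteq> {}"
  shows "slee V E < slee V (shift u v (E `` {v} - E `` {u} - {u}) E)"
proof -
  define S where "S = E `` {v} - E `` {u} - {u}"
  define \<tau> where "\<tau> x = (if x = u then v else if x = v then u else x)" for x
  define s :: "'a \<Rightarrow> real" where "s x = (if x = v then -1 else 1)" for x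
  have vS: "v \<notin> S" using sgraph_neq[OF G] by (auto simp: S_def)
  have fin: "finite (E `` A)" for A by (rule sgraph_finite_nbrs[OF G])
  have "slee V E < slee V (shift u v S E)"
  proof (rule slee_shift_less[OF G uV uv])
    show "signed_involution V \<tau> s"
      using uV vV uv by (auto simp: signed_involution_def \<tau>_def s_def)
    show "(s x = 1 \<and> s y = 1) \<or> y = \<tau> x \<or> (s (\<tau> x) = 1 \<and> s (\<tau> y) = 1 \<and> (\<tau> x, \<tau> y) \<in> E)"
      if "(x, y) \<in> E - ({v} \<times> S \<union> S \<times> {v})" for x y
    proof -
      have common: "(u, w) \<in> E" if "(v, w) \<in> E" "w \<notin> S" "w \<noteq> u" for w
        using that by (simp add: S_def)
      have "(v, x) \<in> E" "(u, x) \<in> E \<Longrightarrow> (x, u) \<in> E" if "y = v"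
        using that \<open>(x, y) \<in> E - _\<close> sgraph_sym[OF G] by blast+
      moreover have "x \<noteq> y" using that sgraph_neq[OF G] by blast
      ultimately show ?thesis
        using that common[of x] common[of y] uv
        by (cases "x = v"; cases "y = v"; cases "x = u"; cases "y = u") (simp_all add: s_def \<tau>_def)
    qed
    have "deg E v < deg E u + card S"
    proof -
      have "E `` {v} - S - {u} \<subset> E `` {u} - {v}"
        using pu sgraph_neq[OF G] by (auto simp: S_def)
      then have less: "card (E `` {v} - S - {u}) < card (E `` {u} - {v})"
        by (intro psubset_card_mono) (simp_all add: fin)
      have iff: "u \<in> E `` {v} \<longleftrightarrow> v \<in> E `` {u}" using sgraph_sym[OF G] by auto
      have eq: "card (E `` {v} - S) = deg E v - card S" and le: "card S \<le> deg E v"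
        using fin by (auto simp: S_def intro!: card_Diff_subset card_mono)
      show ?thesis
      proof (cases "u \<in> E `` {v}")
        case True
        then have "u \<in> E `` {v} - S" by (simp add: S_def)
        then show ?thesis using less eq True iff fin le by (simp add: card_Diff_singleton)
      next
        case False
        then show ?thesis using less eq iff fin le by simp
      qed
    qed
    then show "deg E v < deg E u + card S" .
  qed (use pv vS in \<open>auto simp: S_def \<tau>_def s_def uv\<close>)
  then show ?thesis by (simp add: S_def)
qed

section \<open>Unicyclic graphs and triangles with pendent vertices\<close>

text \<open>
  Unicyclic graphs in terms of vertex and arc sets. Every edge is two arcs, hence the factor 2.
\<close>

definition unicyc :: "'a set \<Rightarrow> 'a rel \<Rightarrow> bool" where
  "unicyc V E \<longleftrightarrow> sgraph V E \<and> V \<noteq> {} \<and> (\<forall>x\<in>V. \<forall>y\<in>V. (x, y) \<in> E\<^sup>*) \<and> card E = 2 * card V"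

lemma card_arcs_eq_edges:
  assumes fin: "finite (parcs G)" and sym: "sym (parcs G)" and irr: "irrefl (parcs G)"
  shows "card (parcs G) = 2 * card (edges G)"
proof -
  let ?f = "\<lambda>(u, v). {u, v}"
  have edges: "edges G = ?f ` parcs G" by (auto simp: edges_def)
  have "card (parcs G) = (\<Sum>e\<in>?f ` parcs G. card {a \<in> parcs G. ?f a = e})"
    using sum.image_gen[OF fin, of "\<lambda>_. 1 :: nat" ?f] by simp
  also have "\<dots> = (\<Sum>e\<in>?f ` parcs G. 2)"
  proof (rule sum.cong[OF refl])
    fix e assume "e \<in> ?f ` parcs G"
    then obtain u v where uv: "(u, v) \<in> parcs G" "e = {u, v}" by auto
    have "(v, u) \<in> parcs G" using uv sym by (auto dest: symD)
    have iff: "?f a = e \<longleftrightarrow> a = (u, v) \<or> a = (v, u)" for a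
      by (cases a) (simp add: uv doubleton_eq_iff)
    have "{a \<in> parcs G. ?f a = e} = {(u, v), (v, u)}"
      unfolding iff using uv(1) \<open>(v, u) \<in> parcs G\<close> by blast
    moreover have "u \<noteq> v" using uv irr by (auto simp: irrefl_def)
    ultimately show "card {a \<in> parcs G. ?f a = e} = 2" by simp
  qed
  finally show ?thesis by (simp add: edges)
qed

lemma unicyclic_imp_unicyc:
  assumes "unicyclic G"
  shows "unicyc (pverts G) (parcs G)"
proof -
  interpret pair_graph G using assms by (simp add: unicyclic_def)
  have sym: "sym (parcs G)" using arcs_symmetric by (auto simp: sym_def)
  have irr: "irrefl (parcs G)" using pair_no_loops by (fastforce simp: irrefl_def)
  have sg: "sgraph (pverts G) (parcs G)"
    using sym irr pair_finite_verts in_arcsD1 in_arcsD2 by (auto simp: sgraph_def)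
  have "parcs (mk_symmetric (with_proj G)) = parcs G"
    using sym by (auto simp: mk_symmetric_def dest: symD)
  moreover have "pverts (mk_symmetric (with_proj G)) = pverts G" by (simp add: mk_symmetric_def)
  moreover have "strongly_connected (with_proj (mk_symmetric (with_proj G)))"
    using assms by (simp add: unicyclic_def connected_def)
  ultimately have "pverts G \<noteq> {}" "\<And>x y. x \<in> pverts G \<Longrightarrow> y \<in> pverts G \<Longrightarrow> (x, y) \<in> rtrancl_on (pverts G) (parcs G)"
    unfolding strongly_connected_def reachable_def by simp_all
  then show ?thesis
    using sg assms card_arcs_eq_edges[OF pair_finite_arcs sym irr]
    by (auto simp: unicyc_def unicyclic_def dest: rtrancl_on_rtranclI)
qed

text \<open>
  Only paths through \<open>v\<close> break, and the detour from \<open>v\<close> to \<open>u\<close>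
  uses the edge between them or a common neighbour, neither of which moves.
\<close>

lemma unicyc_shift:
  assumes G: "unicyc V E" and uV: "u \<in> V"
    and S: "S \<subseteq> E `` {v} - E `` {u}" "u \<notin> S"
    and near: "(u, v) \<in> E \<or> E `` {u} \<inter> E `` {v} \<noteq> {}"
  shows "unicyc V (shift u v S E)"
proof -
  have sg: "sgraph V E" using G by (simp add: unicyc_def)
  have vS: "v \<notin> S" using S sgraph_neq[OF sg] by blast
  have sg': "sgraph V (shift u v S E)" using sgraph_shift[OF sg uV] S by blast
  have keep: "(x, y) \<in> shift u v S E" if "(x, y) \<in> E" "x \<noteq> v \<or> y \<notin> S" "x \<notin> S \<or> y \<noteq> v" for x y
    using that by (auto simp: shift_def)
  have uv: "(u, v) \<in> (shift u v S E)\<^sup>* \<and> (v, u) \<in> (shift u v S E)\<^sup>*"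
    using near
  proof
    assume "(u, v) \<in> E"
    then show ?thesis
      using keep[of u v] keep[of v u] sgraph_sym[OF sg] S vS by blast
  next
    assume "E `` {u} \<inter> E `` {v} \<noteq> {}"
    then obtain c where "(u, c) \<in> E" "(v, c) \<in> E" by auto
    moreover from this have "c \<notin> S" "(c, u) \<in> E" "(c, v) \<in> E" using S sgraph_sym[OF sg] by auto
    ultimately have "(u, c) \<in> shift u v S E" "(c, v) \<in> shift u v S E" "(v, c) \<in> shift u v S E" "(c, u) \<in> shift u v S E"
      using keep S(2) vS by metis+
    then show ?thesis by (meson converse_rtrancl_into_rtrancl r_into_rtrancl)
  qed
  have step: "(x, y) \<in> (shift u v S E)\<^sup>*" if "(x, y) \<in> E" for x y
  proof (cases "x = v \<and> y \<in> S \<or> x \<in> S \<and> y = v")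
    case True
    have "(u, w) \<in> shift u v S E \<and> (w, u) \<in> shift u v S E" if "w \<in> S" for w
      using that by (auto simp: shift_def)
    then show ?thesis using True uv by (meson converse_rtrancl_into_rtrancl rtrancl.rtrancl_into_rtrancl)
  qed (use keep[OF that] in auto)
  have "E\<^sup>* \<subseteq> (shift u v S E)\<^sup>*"
    using step by (intro rtrancl_subset_rtrancl) auto
  then show ?thesis
    using G sg' card_shift[OF sg S] by (auto simp: unicyc_def)
qed

lemma graph_isoI:
  assumes "inj_on f V" "E \<subseteq> V \<times> V" "f ` V = V'" "map_prod f f ` E = E'"
  shows "graph_iso \<lparr>pverts = V, parcs = E\<rparr> \<lparr>pverts = V', parcs = E'\<rparr>"
proof -
  let ?h = "\<lparr>iso_verts = f, iso_arcs = map_prod f f, iso_head = snd, iso_tail = fst\<rparr>"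
  have "inj_on (map_prod f f) E"
    by (rule inj_on_subset[OF map_prod_inj_on[OF assms(1,1)] assms(2)])
  then have "pre_digraph.digraph_isomorphism (with_proj \<lparr>pverts = V, parcs = E\<rparr>) ?h"
    using assms by (auto simp: pre_digraph.digraph_isomorphism_def wf_digraph_def)
  moreover have "with_proj \<lparr>pverts = V', parcs = E'\<rparr> = app_iso ?h (with_proj \<lparr>pverts = V, parcs = E\<rparr>)"
    using assms by (simp add: app_iso_def with_proj_def)
  ultimately show ?thesis unfolding graph_iso_def digraph_iso_def by blast
qed

lemma graph_isoE:
  assumes "graph_iso G H"
  obtains f where "inj_on f (pverts G)" "f ` pverts G = pverts H" "map_prod f f ` parcs G = parcs H"
proof -
  obtain h where h: "pre_digraph.digraph_isomorphism (with_proj G) h" "with_proj H = app_iso h (with_proj G)"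
    using assms unfolding graph_iso_def digraph_iso_def by blast
  have *: "pverts H = iso_verts h ` pverts G" "parcs H = iso_arcs h ` parcs G" "fst = iso_tail h" "snd = iso_head h"
    using h(2) by (simp_all add: with_proj_def app_iso_def)
  have "iso_arcs h a = map_prod (iso_verts h) (iso_verts h) a" if "a \<in> parcs G" for a
    using h(1) that unfolding pre_digraph.digraph_isomorphism_def *(3,4)[symmetric]
    by (simp add: prod_eq_iff)
  then have "map_prod (iso_verts h) (iso_verts h) ` parcs G = parcs H"
    unfolding *(2) by (intro image_cong) auto
  moreover have "inj_on (iso_verts h) (pverts G)"
    using h(1) by (simp add: pre_digraph.digraph_isomorphism_def)
  ultimately show ?thesis using that *(1) by blast
qed

lemma SLEE_graph_iso:
  assumes iso: "graph_iso G H" and G: "sgraph (pverts G) (parcs G)" and H: "sgraph (pverts H) (parcs H)"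
  shows "SLEE G = SLEE H"
proof -
  obtain f where f: "inj_on f (pverts G)" "f ` pverts G = pverts H" "map_prod f f ` parcs G = parcs H"
    using graph_isoE[OF iso] .
  have arcs: "(f x, f y) \<in> parcs H \<longleftrightarrow> (x, y) \<in> parcs G" if "x \<in> pverts G" "y \<in> pverts G" for x y
  proof
    assume "(f x, f y) \<in> parcs H"
    then have "(f x, f y) \<in> map_prod f f ` parcs G" using f(3) by simp
    then obtain a b where "(a, b) \<in> parcs G" "f x = f a" "f y = f b" by auto
    moreover from this have "a = x" "b = y"
      using sgraph_mem[OF G, of a b] that f(1) by (auto dest: inj_onD)
    ultimately show "(x, y) \<in> parcs G" by simp
  next
    assume "(x, y) \<in> parcs G"
    then show "(f x, f y) \<in> parcs H" using f(3) by force
  qed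
  have nbrs: "parcs H `` {f x} = f ` (parcs G `` {x})" if "x \<in> pverts G" for x
  proof
    show "parcs H `` {f x} \<subseteq> f ` (parcs G `` {x})"
      using arcs[OF that] sgraph_mem[OF H] f(2) by fastforce
    show "f ` (parcs G `` {x}) \<subseteq> parcs H `` {f x}"
      using arcs[OF that] sgraph_mem[OF G] by auto
  qed
  have deg: "deg (parcs H) (f x) = deg (parcs G) x" if "x \<in> pverts G" for x
    unfolding nbrs[OF that] using f(1) sgraph_mem[OF G] by (intro card_image) (auto simp: inj_on_def)
  have Q: "Qmat (parcs H) (f x) (f y) = Qmat (parcs G) x y" if "x \<in> pverts G" "y \<in> pverts G" for x y
    using that f(1) by (auto simp: Qmat_def deg arcs dest: inj_onD)
  have P: "fun_mat_pow (pverts H) (Qmat (parcs H)) k (f x) (f y) = fun_mat_pow (pverts G) (Qmat (parcs G)) k x y"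
    if "x \<in> pverts G" "y \<in> pverts G" for x y k
    using that
  proof (induction k arbitrary: y)
    case 0
    then show ?case using f(1) by (auto dest: inj_onD)
  next
    case (Suc k)
    then show ?case by (simp add: f(2)[symmetric] sum.reindex[OF f(1)] Q)
  qed
  have "trace_pow (pverts H) (Qmat (parcs H)) k = trace_pow (pverts G) (Qmat (parcs G)) k" for k
    unfolding trace_pow_def f(2)[symmetric] sum.reindex[OF f(1)]
    by (simp add: P f(2))
  moreover have "(\<lambda>k. trace_pow (pverts G) (Qmat (parcs G)) k / fact k) sums SLEE G"
    and "(\<lambda>k. trace_pow (pverts H) (Qmat (parcs H)) k / fact k) sums SLEE H"
    using G H by (auto simp: sgraph_def intro: SLEE_sums_trace_pow)
  ultimately show ?thesis by (simp add: sums_iff)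
qed

definition tri_arcs :: "'a \<Rightarrow> 'a \<Rightarrow> 'a \<Rightarrow> 'a set \<Rightarrow> 'a set \<Rightarrow> 'a rel" where
  "tri_arcs u v y P Q = (let B = {(u, v), (u, y), (v, y)} \<union> {u} \<times> P \<union> {v} \<times> Q in B \<union> B\<inverse>)"

text \<open>
  The graph \<open>C\<^sub>3S(card P, card Q, 0)\<close> on named vertices: a triangle \<open>u v
  y\<close> with pendent vertices \<open>P\<close> at \<open>u\<close> and \<open>Q\<close> at
  \<open>v\<close>.
\<close>

definition is_tri :: "'a set \<Rightarrow> 'a rel \<Rightarrow> 'a \<Rightarrow> 'a \<Rightarrow> 'a \<Rightarrow> 'a set \<Rightarrow> 'a set \<Rightarrow> bool" where
  "is_tri V E u v y P Q \<longleftrightarrow> u \<noteq> v \<and> u \<noteq> y \<and> v \<noteq> y \<and> finite P \<and> finite Q \<and> P \<inter> Q = {}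
     \<and> {u, v, y} \<inter> (P \<union> Q) = {} \<and> V = {u, v, y} \<union> P \<union> Q \<and> E = tri_arcs u v y P Q"

lemma tri_arcs_commute: "tri_arcs v u y Q P = tri_arcs u v y P Q"
  unfolding tri_arcs_def Let_def by auto

lemma is_tri_sgraph:
  assumes "is_tri V E u v y P Q"
  shows "sgraph V E"
proof -
  let ?B = "{(u, v), (u, y), (v, y)} \<union> {u} \<times> P \<union> {v} \<times> Q"
  have E: "E = ?B \<union> ?B\<inverse>" using assms by (simp add: is_tri_def tri_arcs_def Let_def)
  have "?B \<subseteq> V \<times> V" and "\<forall>x. (x, x) \<notin> ?B" and "finite V"
    using assms by (auto simp: is_tri_def)
  then show ?thesis unfolding sgraph_def E irrefl_def by (intro conjI sym_Un_converse) blast+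
qed

lemma is_tri_card:
  assumes "is_tri V E u v y P Q"
  shows "card V = 3 + card P + card Q"
proof -
  have V: "V = {u, v, y} \<union> (P \<union> Q)" using assms by (auto simp: is_tri_def)
  have "card V = card {u, v, y} + card (P \<union> Q)"
    unfolding V by (rule card_Un_disjoint) (use assms in \<open>auto simp: is_tri_def\<close>)
  also have "card (P \<union> Q) = card P + card Q"
    by (rule card_Un_disjoint) (use assms in \<open>auto simp: is_tri_def\<close>)
  finally show ?thesis using assms by (simp add: is_tri_def)
qed

lemma is_tri_swap: "is_tri V E u v y P Q \<Longrightarrow> is_tri V E v u y Q P"
  unfolding is_tri_def tri_arcs_commute[of v u] by (elim conjE, intro conjI) (assumption | blast)+

lemma is_tri_iso:
  assumes 1: "is_tri V E u v y P Q" and 2: "is_tri V' E' u' v' y' P' Q'"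
    and card: "card P = card P'" "card Q = card Q'"
  shows "graph_iso \<lparr>pverts = V, parcs = E\<rparr> \<lparr>pverts = V', parcs = E'\<rparr>"
proof -
  obtain g where g: "bij_betw g P P'"
    using 1 2 card finite_same_card_bij[of P P'] by (metis is_tri_def)
  obtain h where h: "bij_betw h Q Q'"
    using 1 2 card finite_same_card_bij[of Q Q'] by (metis is_tri_def)
  define f where "f x = (if x = u then u' else if x = v then v' else if x = y then y'
    else if x \<in> P then g x else h x)" for x
  have fu: "f u = u'" "f v = v'" "f y = y'" using 1 by (auto simp: f_def is_tri_def)
  have fP: "f ` P = P'"
  proof -
    have *: "f x = g x" if "x \<in> P" for x using 1 that by (auto simp: f_def is_tri_def)
    show ?thesis using g * by (auto simp: bij_betw_def)
  qed
  have fQ: "f ` Q = Q'"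
  proof -
    have *: "f x = h x" if "x \<in> Q" for x using 1 that by (auto simp: f_def is_tri_def)
    show ?thesis using h * by (auto simp: bij_betw_def)
  qed
  have V: "V = {u, v, y} \<union> P \<union> Q" and V': "V' = {u', v', y'} \<union> P' \<union> Q'"
    and E: "E = tri_arcs u v y P Q" and E': "E' = tri_arcs u' v' y' P' Q'"
    using 1 2 by (simp_all add: is_tri_def)
  have fV: "f ` V = V'" unfolding V V' by (simp add: image_Un fu fP fQ)
  have "finite V" "card V' = card V"
    using is_tri_sgraph[OF 1] card is_tri_card[OF 1] is_tri_card[OF 2] by (simp_all add: sgraph_def)
  then have inj: "inj_on f V" using fV by (metis eq_card_imp_inj_on)
  have times: "map_prod f f ` ({a} \<times> A) = {f a} \<times> f ` A" for a A by auto
  have conv: "map_prod f f ` (B\<inverse>) = (map_prod f f ` B)\<inverse>" for B by force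
  have "map_prod f f ` E = E'"
    unfolding E E' tri_arcs_def Let_def
    by (simp only: image_Un conv times fu fP fQ image_insert image_empty map_prod_simp)
  then show ?thesis
    using graph_isoI[OF inj _ fV] is_tri_sgraph[OF 1] by (auto simp: sgraph_def)
qed

lemma CS_is_tri:
  "is_tri (pverts (CS [a, b, 0])) (parcs (CS [a, b, 0])) (0, 0) (Suc 0, 0) (2, 0)
     (Pair 0 ` {1..a}) (Pair (Suc 0) ` {1..b})"
proof -
  have less3: "i < Suc (Suc (Suc 0)) \<longleftrightarrow> i = 0 \<or> i = Suc 0 \<or> i = 2" for i :: nat by auto
  have V: "pverts (CS [a, b, 0]) = {(0, 0), (Suc 0, 0), (2, 0)} \<union> Pair 0 ` {1..a} \<union> Pair (Suc 0) ` {1..b}"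
    unfolding CS_def Let_def by (auto simp: less3 image_iff nth_Cons numeral_2_eq_2 split: nat.splits)
  let ?C = "{((i, 0), (Suc i mod length [a, b, 0], 0)) | i. i < length [a, b, 0]} :: ((nat \<times> nat) \<times> (nat \<times> nat)) set"
  let ?D = "{((i, 0), (i, k)) | i k. i < length [a, b, 0] \<and> 1 \<le> k \<and> k \<le> [a, b, 0] ! i} :: ((nat \<times> nat) \<times> (nat \<times> nat)) set"
  have C: "?C = {((0, 0), (Suc 0, 0)), ((Suc 0, 0), (2, 0)), ((2, 0), (0, 0))}"
    by (auto simp: less3 numeral_2_eq_2)
  have D: "?D = {(0, 0)} \<times> Pair 0 ` {1..a} \<union> {(Suc 0, 0)} \<times> Pair (Suc 0) ` {1..b}"
    by (auto simp: less3 numeral_2_eq_2)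
  have E: "parcs (CS [a, b, 0]) = tri_arcs (0, 0) (Suc 0, 0) (2, 0) (Pair 0 ` {1..a}) (Pair (Suc 0) ` {1..b})"
    unfolding CS_def Let_def pair_pre_digraph.simps C D tri_arcs_def by auto
  show ?thesis unfolding is_tri_def V E by auto
qed

lemma card_2_sym_irrefl:
  assumes "card I = 2" "\<And>x y. (x, y) \<in> I \<Longrightarrow> (y, x) \<in> I \<and> x \<noteq> y"
  obtains x y where "x \<noteq> y" "I = {(x, y), (y, x)}"
proof -
  obtain a b where ab: "I = {a, b}" "a \<noteq> b" using assms(1) by (meson card_2_iff)
  obtain x y where a: "a = (x, y)" by fastforce
  then have "(y, x) \<in> I" "x \<noteq> y" using assms(2)[of x y] ab by auto
  then have "b = (y, x)" using ab a by auto
  then show ?thesis using that[of x y] ab a \<open>x \<noteq> y\<close> by simp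
qed

text \<open>
  The arcs at the dominating vertex number \<open>2 (n - 1)\<close>, which leaves a single edge.
\<close>

lemma unicyc_dominating_is_tri:
  assumes G: "unicyc V E" and uV: "u \<in> V" and dom: "\<And>x. x \<in> V \<Longrightarrow> x \<noteq> u \<Longrightarrow> (u, x) \<in> E"
  obtains v y P where "is_tri V E u v y P {}"
proof -
  have sg: "sgraph V E" and card: "card E = 2 * card V" using G by (auto simp: unicyc_def)
  have fin: "finite V" using sg by (simp add: sgraph_def)
  have finE: "finite E" by (rule sgraph_finite[OF sg])
  define W where "W = V - {u}"
  define D where "D = {u} \<times> W \<union> W \<times> {u}"
  define I where "I = E - D"
  have DE: "D \<subseteq> E" using dom sgraph_sym[OF sg] by (auto simp: D_def W_def)
  have "card D = 2 * card W"
    unfolding D_def using fin by (subst card_Un_disjoint) (auto simp: W_def card_cartesian_product)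
  moreover have "card V = Suc (card W)" unfolding W_def by (rule card.remove[OF fin uV])
  ultimately have "card I = 2" using card DE finE card_Diff_subset[OF finite_subset[OF DE finE] DE] by (simp add: I_def)
  moreover have "(y, x) \<in> I \<and> x \<noteq> y" if "(x, y) \<in> I" for x y
    using that sgraph_sym[OF sg, of x y] sgraph_neq[OF sg, of x y] by (auto simp: I_def D_def)
  ultimately obtain v y where vy: "v \<noteq> y" "I = {(v, y), (y, v)}" using card_2_sym_irrefl by metis
  then have "(v, y) \<in> E" "(v, y) \<notin> D" by (auto simp: I_def)
  then have mem: "v \<in> V" "y \<in> V" "v \<noteq> u" "y \<noteq> u"
    using sgraph_mem[OF sg, of v y] vy(1) by (auto simp: D_def W_def)
  have "is_tri V E u v y (V - {u, v, y}) {}"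
    unfolding is_tri_def
  proof (intro conjI)
    have "E = D \<union> I" using DE unfolding I_def by blast
    then show "E = tri_arcs u v y (V - {u, v, y}) {}"
      unfolding vy(2) tri_arcs_def Let_def D_def W_def using mem by auto
  qed (use vy mem uV fin in auto)
  then show ?thesis by (rule that)
qed

section \<open>Transformations of triangles and dominating vertices\<close>

lemma is_tri_nbrs:
  assumes "is_tri V E u v y P Q"
  shows "E `` {u} = {v, y} \<union> P" "E `` {v} = {u, y} \<union> Q"
proof -
  have E: "E = tri_arcs u v y P Q"
    and ne: "u \<noteq> v" "u \<noteq> y" "v \<noteq> y" "u \<notin> P" "v \<notin> P" "u \<notin> Q" "v \<notin> Q"
    using assms by (simp_all add: is_tri_def)
  show "E `` {u} = {v, y} \<union> P" "E `` {v} = {u, y} \<union> Q"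
    unfolding E tri_arcs_def Let_def using ne by auto
qed

lemma is_tri_shift:
  assumes tri: "is_tri V E u v y P Q" and S: "S \<subseteq> Q"
  shows "is_tri V (shift u v S E) u v y (P \<union> S) (Q - S)"
proof -
  have E: "E = tri_arcs u v y P Q" using tri by (simp add: is_tri_def)
  have ne: "u \<notin> S" "v \<notin> S" "y \<notin> S" "u \<noteq> v" "u \<noteq> y" "y \<noteq> v" "v \<notin> P"
    using tri S by (auto simp: is_tri_def)
  have "shift u v S E = tri_arcs u v y (P \<union> S) (Q - S)"
  proof (unfold set_eq_iff split_paired_All, intro allI)
    fix a b
    show "(a, b) \<in> shift u v S E \<longleftrightarrow> (a, b) \<in> tri_arcs u v y (P \<union> S) (Q - S)"
      unfolding E shift_def tri_arcs_def Let_def using ne S by auto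
  qed
  moreover have "finite S" using finite_subset[OF S] tri by (simp add: is_tri_def)
  moreover have "V = {u, v, y} \<union> (P \<union> S) \<union> (Q - S)" using tri S by (auto simp: is_tri_def)
  ultimately show ?thesis using tri S unfolding is_tri_def by simp blast
qed

text \<open>
  The Kelmans transformation would move all of \<open>Q\<close> and create a dominating vertex. The
  involution \<open>(u v)(p q)\<close> with some \<open>p\<close> in \<open>P\<close> pairs the pendent
  edges \<open>u p\<close> and \<open>v q\<close>, so that \<open>q\<close> stays behind.
\<close>

lemma slee_tri_shift_less:
  assumes tri: "is_tri V E u v y P Q" and le: "card Q \<le> card P" and q: "q \<in> Q" "Q \<noteq> {q}"
  shows "slee V E < slee V (shift u v (Q - {q}) E)"
proof -
  have sg: "sgraph V E" by (rule is_tri_sgraph[OF tri])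
  have fin: "finite P" "finite Q" using tri by (auto simp: is_tri_def)
  then have "P \<noteq> {}" using le q(1) by auto
  then obtain p where p: "p \<in> P" by blast
  have ne: "u \<noteq> v" "u \<noteq> y" "v \<noteq> y" "u \<notin> P" "v \<notin> P" "y \<notin> P" "u \<notin> Q" "v \<notin> Q" "y \<notin> Q" "P \<inter> Q = {}"
    and V: "V = {u, v, y} \<union> P \<union> Q" and E: "E = tri_arcs u v y P Q"
    using tri by (simp_all add: is_tri_def)
  define S where "S = Q - {q}"
  define \<tau> where "\<tau> x = (if x = u then v else if x = v then u else if x = p then q else if x = q then p else x)" for x
  define s :: "'a \<Rightarrow> real" where "s x = (if x = v \<or> x = q then -1 else 1)" for x
  have "q \<notin> P" using ne q by blast
  have "p \<noteq> u" "p \<noteq> v" "p \<noteq> y" "p \<noteq> q" "q \<noteq> u" "q \<noteq> v" "q \<noteq> y" using ne p q by auto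
  note ne' = ne(1-3) this
  have tau: "\<tau> u = v" "\<tau> v = u" "\<tau> p = q" "\<tau> q = p" "\<tau> x = x" if "x \<notin> {u, v, p, q}" for x
    using ne' that by (simp_all add: \<tau>_def)
  have s: "s u = 1" "s v = -1" "s p = 1" "s q = -1" "s x = 1" if "x \<notin> {u, v, p, q}" for x
    using ne' that by (simp_all add: s_def)
  have "slee V E < slee V (shift u v S E)"
  proof (rule slee_shift_less[OF sg])
    show "signed_involution V \<tau> s"
      unfolding signed_involution_def
    proof (intro conjI allI)
      fix x show "\<tau> (\<tau> x) = x" using ne' by (simp add: \<tau>_def)
      show "s x = 1 \<or> s x = -1" by (simp add: s_def)
      show "s (\<tau> x) = (if \<tau> x = x then 1 else - s x)" using ne' by (simp add: \<tau>_def s_def)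
    next
      show "\<tau> ` V \<subseteq> V" using p q V by (auto simp: \<tau>_def)
    qed
    show "\<tau> w = w" if "w \<in> S" for w using that ne p by (intro tau(5)) (auto simp: S_def)
    show "(s x = 1 \<and> s z = 1) \<or> z = \<tau> x \<or> (s (\<tau> x) = 1 \<and> s (\<tau> z) = 1 \<and> (\<tau> x, \<tau> z) \<in> E)"
      if xz: "(x, z) \<in> E - ({v} \<times> S \<union> S \<times> {v})" for x z
    proof -
      have sy: "s y = 1" "\<tau> y = y" using ne' by (simp_all add: s_def \<tau>_def)
      have sP: "s a = 1" if "a \<in> P" for a using that ne q by (auto simp: s_def)
      have arcs: "(u, y) \<in> E" "(y, u) \<in> E" "(u, p) \<in> E" "(p, u) \<in> E"
        using p by (auto simp: E tri_arcs_def Let_def)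
      have "(x, z) \<in> {(u, v), (v, u), (u, y), (y, u), (v, y), (y, v), (v, q), (q, v)}
          \<or> x = u \<and> z \<in> P \<or> x \<in> P \<and> z = u"
        using xz by (auto simp: E tri_arcs_def Let_def S_def)
      then show ?thesis using sy sP arcs ne' \<open>q \<notin> P\<close> by (auto simp: s_def \<tau>_def)
    qed
    have "card Q > card {q}" using q fin by (intro psubset_card_mono) auto
    then have "card S > 0" "finite S" using fin q by (simp_all add: S_def card_gt_0_iff)
    then show "S \<noteq> {}" by auto
    have "deg E u = 2 + card P" "deg E v = 2 + card Q"
      unfolding is_tri_nbrs[OF tri] using ne fin by (simp_all add: card_insert_if)
    then show "deg E v < deg E u + card S" using le \<open>card S > 0\<close> by simp
    show "S \<subseteq> E `` {v} - E `` {u}" unfolding is_tri_nbrs[OF tri] S_def using ne by auto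
  qed (use ne ne' V s tau in \<open>auto simp: S_def s_def \<tau>_def\<close>)
  then show ?thesis by (simp add: S_def)
qed

lemma slee_tri_absorb_less:
  assumes tri: "is_tri V E u v y P {q}" and P: "P \<noteq> {}"
  shows "slee V E < slee V (shift u v {q} E)"
proof -
  have ne: "u \<noteq> v" "u \<noteq> y" "v \<noteq> y" "u \<notin> P" "v \<notin> P" "y \<notin> P" "u \<noteq> q" "v \<noteq> q" "y \<noteq> q" "q \<notin> P"
    and V: "V = {u, v, y} \<union> P \<union> {q}"
    using tri by (auto simp: is_tri_def)
  have *: "E `` {v} - E `` {u} - {u} = {q}" "E `` {u} - E `` {v} - {v} = P"
    unfolding is_tri_nbrs[OF tri] using ne by auto
  have "slee V E < slee V (shift u v (E `` {v} - E `` {u} - {u}) E)"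
    by (rule slee_kelmans_less[OF is_tri_sgraph[OF tri]]) (use ne V P * in auto)
  then show ?thesis unfolding *(1) .
qed

definition no_dominating :: "'a set \<Rightarrow> 'a rel \<Rightarrow> bool" where
  "no_dominating V E \<longleftrightarrow> (\<forall>x\<in>V. \<exists>z\<in>V. z \<noteq> x \<and> (x, z) \<notin> E)"

text \<open>
  Only the degree of \<open>u\<close> grows, so \<open>u\<close> is the only candidate for a dominating
  vertex.
\<close>

lemma kelmans_no_dominating:
  assumes sg: "sgraph V E" and dom: "no_dominating V E"
    and u: "u \<in> V" and v: "v \<in> V" and uv: "u \<noteq> v"
    and far: "(u, v) \<notin> E \<or> \<not> V \<subseteq> E `` {u} \<union> E `` {v}"
  shows "no_dominating V (shift u v (E `` {v} - E `` {u} - {u}) E)"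
proof -
  define S where "S = E `` {v} - E `` {u} - {u}"
  have S: "S \<subseteq> E `` {v}" "u \<notin> S" by (auto simp: S_def)
  have vS: "v \<notin> S" using sgraph_neq[OF sg] by (auto simp: S_def)
  note nb = shift_nbrs[OF sg S uv]
  have "\<exists>z\<in>V. z \<noteq> x \<and> z \<notin> shift u v S E `` {x}" if x: "x \<in> V" for x
  proof -
    obtain z where z: "z \<in> V" "z \<noteq> x" "z \<notin> E `` {x}" using dom x by (auto simp: no_dominating_def)
    consider "x = u" | "x = v" | "x \<noteq> u" "x \<noteq> v" "x \<in> S" | "x \<noteq> u" "x \<noteq> v" "x \<notin> S" by blast
    then show ?thesis
    proof cases
      case 1
      show ?thesis
      proof (cases "(u, v) \<in> E")
        case True
        then obtain w where "w \<in> V" "w \<notin> E `` {u}" "w \<notin> E `` {v}" using far by blast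
        moreover from this have "w \<noteq> u" using sgraph_sym[OF sg True] by auto
        ultimately show ?thesis using nb(1) S(1) 1 by auto
      next
        case False
        then show ?thesis using nb(1) vS v uv 1 by auto
      qed
    next
      case 2
      then show ?thesis using nb(2) z by auto
    next
      case 3
      then show ?thesis using nb(3)[OF 3(1,2)] v uv by auto
    next
      case 4
      then show ?thesis using nb(3)[OF 4(1,2)] z by auto
    qed
  qed
  then show ?thesis unfolding no_dominating_def S_def by auto
qed

lemma is_tri_no_dominating:
  assumes tri: "is_tri V E u v y P Q" and "P \<noteq> {}" "Q \<noteq> {}"
  shows "no_dominating V E"
  unfolding no_dominating_def
proof
  fix x assume x: "x \<in> V"
  obtain p q where pq: "p \<in> P" "q \<in> Q" using assms(2,3) by blast
  have E: "E = tri_arcs u v y P Q" and V: "V = {u, v, y} \<union> P \<union> Q"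
    and ne: "u \<noteq> v" "u \<noteq> y" "v \<noteq> y" "P \<inter> Q = {}" "u \<notin> P" "v \<notin> P" "y \<notin> P" "u \<notin> Q" "v \<notin> Q" "y \<notin> Q"
    using tri by (simp_all add: is_tri_def)
  define z where "z = (if x \<in> P then v else if x \<in> Q then u else if x = v then p else q)"
  have "z \<in> V" using pq V by (simp add: z_def)
  moreover have "z \<noteq> x" using pq ne by (auto simp: z_def)
  moreover have "(x, z) \<notin> E"
    unfolding E tri_arcs_def Let_def z_def using x[unfolded V] pq ne by auto
  ultimately show "\<exists>z\<in>V. z \<noteq> x \<and> (x, z) \<notin> E" by blast
qed

section \<open>Maximal graphs without dominating vertex\<close>

text \<open>
  Maximality says that a Kelmans transformation with private neighbours on both sides, at distance at
  most two, must create a dominating vertex; on four vertices there can be no such transformation. In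
  particular vertices at distance two have comparable neighbourhoods. If \<open>u\<close> has the
  largest degree, every vertex \<open>w\<close> outside \<open>u\<close> and its neighbourhood
  \<open>N\<close> then has all its neighbours in \<open>N\<close>. Counting arcs leaves two cases: one
  such \<open>w\<close> has degree two and \<open>N\<close> spans no edge, or all of them are pendent
  and \<open>N\<close> spans one edge. The first case is a four-cycle with pendent vertices at
  \<open>u\<close>, which can be improved. In the second case they all hang at one end \<open>v\<close>
  of that edge, and there is only one of them because otherwise all but one could move to
  \<open>u\<close>.
\<close>

lemma maximal_no_dominating_is_tri:
  assumes G: "unicyc V E" and dom: "no_dominating V E"
    and max: "\<And>E'. unicyc V E' \<Longrightarrow> no_dominating V E' \<or> card V = 4 \<Longrightarrow> slee V E' \<le> slee V E"
  obtains u v y P q where "is_tri V E u v y P {q}"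
proof -
  have sg: "sgraph V E" and cardE: "card E = 2 * card V" and Vne: "V \<noteq> {}"
    and conn: "\<And>x y. x \<in> V \<Longrightarrow> y \<in> V \<Longrightarrow> (x, y) \<in> E\<^sup>*"
    using G by (auto simp: unicyc_def)
  have finV: "finite V" using sg by (simp add: sgraph_def)
  have finE: "finite E" by (rule sgraph_finite[OF sg])
  have finN: "finite (E `` A)" for A by (rule sgraph_finite_nbrs[OF sg])
  have sym: "(b, a) \<in> E" if "(a, b) \<in> E" for a b by (rule sgraph_sym[OF sg that])
  have neq: "a \<noteq> b" if "(a, b) \<in> E" for a b by (rule sgraph_neq[OF sg that])
  have mem: "a \<in> V" "b \<in> V" if "(a, b) \<in> E" for a b using sgraph_mem[OF sg that] by auto
  have kel: False if uv: "u \<in> V" "v \<in> V" "u \<noteq> v" and near: "(u, v) \<in> E \<or> E `` {u} \<inter> E `` {v} \<noteq> {}"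
    and far: "(u, v) \<notin> E \<or> \<not> V \<subseteq> E `` {u} \<union> E `` {v} \<or> card V = 4"
    and a: "a \<in> E `` {v}" "a \<notin> E `` {u}" "a \<noteq> u" and b: "b \<in> E `` {u}" "b \<notin> E `` {v}" "b \<noteq> v" for u v a b
  proof -
    let ?S = "E `` {v} - E `` {u} - {u}"
    have "slee V E < slee V (shift u v ?S E)"
      by (rule slee_kelmans_less[OF sg uv]) (use a b in blast)+
    moreover have "unicyc V (shift u v ?S E)"
      by (rule unicyc_shift[OF G uv(1) _ _ near]) auto
    moreover have "no_dominating V (shift u v ?S E) \<or> card V = 4"
      using kelmans_no_dominating[OF sg dom uv] far by blast
    ultimately show False using max by fastforce
  qed
  obtain u where u: "u \<in> V" and umax: "\<And>x. x \<in> V \<Longrightarrow> deg E x \<le> deg E u"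
  proof -
    have "Max (deg E ` V) \<in> deg E ` V" using finV Vne by (intro Max_in) auto
    then obtain u where "u \<in> V" "deg E u = Max (deg E ` V)" by auto
    then show ?thesis using that finV by simp
  qed
  define N where "N = E `` {u}"
  define W where "W = V - {u} - N"
  have finNW: "finite N" "finite W" using finN finV by (auto simp: N_def W_def)
  have uN: "u \<notin> N" using neq by (auto simp: N_def)
  have NV: "N \<subseteq> V" using mem by (auto simp: N_def)
  have V: "V = insert u N \<union> W" using u NV by (auto simp: W_def)
  have Wne: "W \<noteq> {}" using dom u by (auto simp: no_dominating_def W_def N_def)
  have level2: "E `` {w} \<subseteq> N" if w: "w \<in> W" and c: "c \<in> N" "(c, w) \<in> E" for w c
  proof (rule ccontr)
    assume "\<not> E `` {w} \<subseteq> N"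
    then obtain a where a: "a \<in> E `` {w}" "a \<notin> E `` {u}" by (auto simp: N_def)
    have wu: "w \<noteq> u" "(u, w) \<notin> E" using w by (auto simp: W_def N_def)
    have "\<not> E `` {u} \<subseteq> E `` {w}"
    proof
      assume sub: "E `` {u} \<subseteq> E `` {w}"
      then have "E `` {u} \<subset> E `` {w}" using a by blast
      then have "deg E u < deg E w" using finN by (rule psubset_card_mono[rotated])
      then show False using umax[of w] w by (auto simp: W_def)
    qed
    then obtain b where b: "b \<in> E `` {u}" "b \<notin> E `` {w}" by blast
    have "c \<in> E `` {u} \<inter> E `` {w}" using c sym by (auto simp: N_def)
    moreover have "a \<noteq> u" "b \<noteq> w" using a b wu sym by auto
    ultimately show False using kel[of u w a b] a b u w wu by (auto simp: W_def)
  qed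
  have WN: "E `` {w} \<subseteq> N" "E `` {w} \<noteq> {}" if w: "w \<in> W" for w
  proof -
    \<comment> \<open>Everything within distance two of \<open>u\<close>.  It is closed under adjacency, so it is all of \<open>V\<close>.\<close>
    define C where "C = insert u N \<union> {w \<in> W. \<exists>c\<in>N. (c, w) \<in> E}"
    have closed: "b \<in> C" if ac: "a \<in> C" "(a, b) \<in> E" for a b
    proof -
      have bV: "b \<in> insert u N \<union> W" using mem[OF ac(2)] V by blast
      consider "a = u" | "a \<in> N" | c where "a \<in> W" "c \<in> N" "(c, a) \<in> E"
        using ac(1) unfolding C_def by blast
      then show ?thesis
      proof cases
        case 1
        then show ?thesis using ac by (auto simp: C_def N_def)
      next
        case 2
        then show ?thesis using ac bV by (auto simp: C_def)
      next
        case 3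
        then show ?thesis using level2[OF 3] ac by (auto simp: C_def)
      qed
    qed
    have "(u, w) \<in> E\<^sup>*" using conn u w by (auto simp: W_def)
    then have "w \<in> C"
    proof (induction rule: rtrancl_induct)
      case base
      show ?case by (simp add: C_def)
    qed (rule closed)
    then obtain c where "c \<in> N" "(c, w) \<in> E" using w uN by (auto simp: C_def W_def)
    then show "E `` {w} \<subseteq> N" "E `` {w} \<noteq> {}" using level2[OF w] sym by blast+
  qed
  define I where "I = E \<inter> N \<times> N"
  define B where "B = Sigma W (\<lambda>w. E `` {w})"
  have Bsub: "B \<subseteq> W \<times> N" using WN by (auto simp: B_def)
  have E: "E = ({u} \<times> N \<union> N \<times> {u}) \<union> (I \<union> (B \<union> B\<inverse>))"
  proof
    show "E \<subseteq> ({u} \<times> N \<union> N \<times> {u}) \<union> (I \<union> (B \<union> B\<inverse>))"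
    proof (rule subrelI)
      fix a b assume ab: "(a, b) \<in> E"
      then have ba: "(b, a) \<in> E" by (rule sym)
      have "a \<in> insert u N \<union> W" "b \<in> insert u N \<union> W" using mem[OF ab] V by blast+
      moreover have "b \<in> N" if "a \<in> W" using WN(1)[OF that] ab by blast
      moreover have "a \<in> N" if "b \<in> W" using WN(1)[OF that] ba by blast
      ultimately show "(a, b) \<in> ({u} \<times> N \<union> N \<times> {u}) \<union> (I \<union> (B \<union> B\<inverse>))"
        using ab ba unfolding I_def B_def N_def by blast
    qed
    show "({u} \<times> N \<union> N \<times> {u}) \<union> (I \<union> (B \<union> B\<inverse>)) \<subseteq> E"
      using sym unfolding I_def B_def N_def by blast
  qed
  have NW: "N \<inter> W = {}" "u \<notin> W" by (auto simp: W_def)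
  \<comment> \<open>The arc count \<open>2 (1 + card N + card W)\<close> less the \<open>2 card N\<close> arcs at \<open>u\<close>.\<close>
  have count: "card I + 2 * (\<Sum>w\<in>W. deg E w) = 2 + 2 * card W"
  proof -
    have finI: "finite I" using finE by (simp add: I_def)
    have finB: "finite B" using finNW finN by (simp add: B_def)
    have "card (B \<union> B\<inverse>) = card B + card (B\<inverse>)"
      using Bsub NW finB by (intro card_Un_disjoint) auto
    moreover have "card (I \<union> (B \<union> B\<inverse>)) = card I + card (B \<union> B\<inverse>)"
      using Bsub NW finB finI by (intro card_Un_disjoint) (auto simp: I_def)
    moreover have "card ({u} \<times> N \<union> N \<times> {u}) = 2 * card N"
      using uN finNW by (subst card_Un_disjoint) (auto simp: card_cartesian_product)
    moreover have "card E = card ({u} \<times> N \<union> N \<times> {u}) + card (I \<union> (B \<union> B\<inverse>))"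
      by (subst E, rule card_Un_disjoint) (use Bsub NW uN finB finI finNW in \<open>auto simp: I_def\<close>)
    moreover have "card B = (\<Sum>w\<in>W. deg E w)" using finNW finN by (simp add: B_def)
    moreover have "card V = 1 + card N + card W"
      unfolding V using finNW NW uN by (subst card_Un_disjoint) auto
    ultimately show ?thesis using cardE by simp
  qed
  \<comment> \<open>\<open>w\<close> is private to \<open>v\<close>, so by degrees some neighbour is private to \<open>u\<close>.
    Only covering \<open>V\<close> avoids an improvement.\<close>
  have hub: "W \<subseteq> E `` {v}" if v: "v \<in> N" and w: "w \<in> W" "(w, v) \<in> E" for v w
  proof -
    have uv: "(u, v) \<in> E" using v by (simp add: N_def)
    have wv: "w \<in> E `` {v}" using sym[OF w(2)] by simp
    have wu: "w \<notin> E `` {u}" "w \<noteq> u" using w(1) by (auto simp: W_def N_def)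
    have "\<exists>b. b \<in> E `` {u} \<and> b \<notin> E `` {v} \<and> b \<noteq> v"
    proof (rule ccontr)
      assume "\<not> ?thesis"
      then have "E `` {u} - {v} \<subseteq> E `` {v} - {u, w}" using wu uN neq by (auto simp: N_def)
      then have "card (E `` {u} - {v}) \<le> card (E `` {v} - {u, w})" using finN by (intro card_mono) auto
      also have "card (E `` {v} - {u, w}) = deg E v - 2"
        using wv sym[OF uv] wu by (subst card_Diff_subset) auto
      also have "card (E `` {u} - {v}) = deg E u - 1" using uv finN by simp
      finally have "deg E u - 1 \<le> deg E v - 2" .
      moreover have "card {u, w} \<le> deg E v" using wv sym[OF uv] finN by (intro card_mono) auto
      ultimately show False using umax[of v] mem[OF uv] wu by simp
    qed
    then obtain b where "b \<in> E `` {u}" "b \<notin> E `` {v}" "b \<noteq> v" by blast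
    then have "V \<subseteq> E `` {u} \<union> E `` {v}"
      using kel[of u v w b] u mem[OF uv] neq[OF uv] uv wv wu by blast
    then show ?thesis by (auto simp: W_def N_def)
  qed
  obtain w0 where w0: "w0 \<in> W" using Wne by blast
  obtain v where v: "v \<in> E `` {w0}" using WN(2)[OF w0] by blast
  have vN: "v \<in> N" using WN(1)[OF w0] v by blast
  have Wv: "W \<subseteq> E `` {v}" using hub[OF vN w0] v by blast
  have uv: "(u, v) \<in> E" using vN by (simp add: N_def)
  show thesis
  proof (cases "\<exists>w\<in>W. deg E w \<noteq> 1")
    case True
    then obtain w where w: "w \<in> W" "deg E w \<noteq> 1" by blast
    have vw: "v \<in> E `` {w}" using Wv w sym by blast
    have "\<not> E `` {w} \<subseteq> {v}"
      using vw w(2) by (auto simp: subset_singleton_iff)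
    then obtain v' where v': "v' \<in> E `` {w}" "v' \<noteq> v" by blast
    have v'N: "v' \<in> N" using WN(1)[OF w(1)] v' by blast
    have Wv': "W \<subseteq> E `` {v'}" using hub[OF v'N w(1)] v' by blast
    have two: "{v, v'} \<subseteq> E `` {z}" if "z \<in> W" for z using Wv Wv' that sym by blast
    have ge2: "deg E z \<ge> 2" if "z \<in> W" for z
      using card_mono[OF finN two[OF that]] v'(2) by simp
    have sum2: "(\<Sum>z\<in>W. 2) \<le> (\<Sum>z\<in>W. deg E z)" by (rule sum_mono) (rule ge2)
    have "card W \<ge> 1" using w finNW by (simp add: Suc_le_eq card_gt_0_iff) blast
    then have "card W = 1" "card I = 0" "(\<Sum>z\<in>W. deg E z) = 2" using count sum2 by auto
    then have W: "W = {w}" and "deg E w = 2" and I: "I = {}"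
      using w(1) finE by (auto simp: card_1_singleton_iff I_def)
    then have Ew: "E `` {w} = {v, v'}"
      using card_subset_eq[OF finN two[OF w(1)]] v'(2) by simp
    have Ev: "E `` {v} = {u, w}"
    proof -
      have "E `` {v} \<subseteq> insert u N \<union> W" using mem V by blast
      moreover have "z \<notin> N" if "(v, z) \<in> E" for z using that I vN by (auto simp: I_def)
      ultimately show ?thesis using W Wv sym[OF uv] by auto
    qed
    have u_ne: "u \<noteq> v" "u \<noteq> v'" "u \<noteq> w" "w \<noteq> v" "w \<noteq> v'" using uN vN v'N NW w(1) by auto
    \<comment> \<open>Moving \<open>v'\<close> from \<open>w\<close> to \<open>v\<close> turns the four-cycle \<open>u v w v'\<close> into a triangle.\<close>
    have "V \<subseteq> E `` {v} \<union> E `` {w} \<and> card V \<noteq> 4"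
    proof (rule ccontr)
      assume "\<not> ?thesis"
      then have "(v, w) \<notin> E \<or> \<not> V \<subseteq> E `` {v} \<union> E `` {w} \<or> card V = 4" by blast
      moreover have "(v, w) \<in> E" using Ev by auto
      ultimately show False
        using kel[of v w v' u] mem[of v w] u_ne v'(2) by (auto simp: Ev Ew)
    qed
    then have "V \<subseteq> {u, v, v', w}" "card V \<noteq> 4" by (auto simp: Ev Ew)
    moreover have "{u, v, v', w} \<subseteq> V" using u vN v'N NV w(1) by (auto simp: W_def)
    ultimately have "V = {u, v, v', w}" "card V \<noteq> 4" by auto
    then show thesis using u_ne v'(2) by simp
  next
    case False
    then have "card I = 2" using count by simp
    moreover have "(b, a) \<in> I \<and> a \<noteq> b" if "(a, b) \<in> I" for a b
      using that sym neq by (auto simp: I_def)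
    ultimately obtain a b where ab: "a \<noteq> b" "I = {(a, b), (b, a)}" using card_2_sym_irrefl by metis
    have Ew: "E `` {w} = {v}" if "w \<in> W" for w
    proof -
      have "v \<in> E `` {w}" using Wv that sym by blast
      moreover have "card (E `` {w}) = 1" using False that by blast
      ultimately show ?thesis by (metis card_1_singletonE singletonD)
    qed
    \<comment> \<open>Otherwise \<open>v\<close> and \<open>a\<close> share the neighbour \<open>u\<close> and have the private neighbours \<open>w0\<close> and \<open>b\<close>.\<close>
    have "v = a \<or> v = b"
    proof (rule ccontr)
      assume nv: "\<not> ?thesis"
      have aN: "a \<in> N" "b \<in> N" "(a, b) \<in> E" using ab by (auto simp: I_def)
      have va: "(v, a) \<notin> E" "(v, b) \<notin> E" using nv ab(2) vN aN by (auto simp: I_def)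
      have "w0 \<notin> E `` {a}"
      proof
        assume "w0 \<in> E `` {a}"
        then have "a \<in> E `` {w0}" using sym by blast
        then show False using Ew[OF w0] nv by simp
      qed
      moreover have "u \<in> E `` {v} \<inter> E `` {a}" using sym[OF uv] aN(1) sym[of u a] by (simp add: N_def)
      moreover have "w0 \<noteq> a" "w0 \<in> E `` {v}" using w0 aN NW Wv by auto
      moreover have "v \<in> V" "a \<in> V" using vN aN NV by auto
      moreover have "b \<in> E `` {a}" "b \<notin> E `` {v}" "v \<noteq> a" "b \<noteq> v" using aN va nv by auto
      ultimately show False using kel[of v a b w0] va by blast
    qed
    then obtain y where y: "v \<noteq> y" "I = {(v, y), (y, v)}"
    proof
      assume "v = a"
      then show thesis using ab that by blast
    next
      assume "v = b"
      then show thesis using ab that[of a] by (simp add: insert_commute)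
    qed
    have yN: "y \<in> N" using y(2) by (auto simp: I_def)
    have B: "B = W \<times> {v}" unfolding B_def using Ew by auto
    define P where "P = N - {v, y}"
    have N: "N = {v, y} \<union> P" using vN yN by (auto simp: P_def)
    have tri: "is_tri V E u v y P W"
      unfolding is_tri_def
    proof (intro conjI)
      show "E = tri_arcs u v y P W"
      proof -
        have "E = ({u} \<times> ({v, y} \<union> P) \<union> ({v, y} \<union> P) \<times> {u}) \<union> ({(v, y), (y, v)} \<union> (W \<times> {v} \<union> (W \<times> {v})\<inverse>))"
          using E unfolding y(2) B N .
        then show ?thesis unfolding tri_arcs_def Let_def by blast
      qed
      show "V = {u, v, y} \<union> P \<union> W" using V N by blast
    qed (use y uN vN yN NW finNW in \<open>auto simp: P_def\<close>)
    have "W = {w0}"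
    proof (rule ccontr)
      assume W: "W \<noteq> {w0}"
      let ?E' = "shift u v (W - {w0}) E"
      have "deg E v \<le> deg E u" using umax vN NV by blast
      then have "card W \<le> card P"
        unfolding is_tri_nbrs[OF tri] using tri by (simp add: is_tri_def card_insert_if)
      then have less: "slee V E < slee V ?E'" by (rule slee_tri_shift_less[OF tri _ w0 W])
      have tri': "is_tri V ?E' u v y (P \<union> (W - {w0})) {w0}"
        using is_tri_shift[OF tri, of "W - {w0}"] w0 by (simp add: double_diff)
      have uni: "unicyc V ?E'"
      proof (rule unicyc_shift[OF G u])
        have "W \<inter> ({v, y} \<union> P) = {}" using NW N by blast
        then show "W - {w0} \<subseteq> E `` {v} - E `` {u}" unfolding is_tri_nbrs[OF tri] by blast
      qed (use NW uv in auto)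
      have "P \<union> (W - {w0}) \<noteq> {}" using W w0 by blast
      then have "no_dominating V ?E'" using is_tri_no_dominating[OF tri'] by blast
      then show False using max[OF uni] less by simp
    qed
    then show thesis using tri that by blast
  qed
qed

section \<open>The two largest indices\<close>

lemma graph_record_eta: "\<lparr>pverts = pverts G, parcs = parcs G\<rparr> = G"
  by (rule pair_pre_digraph.equality) simp_all

lemma SLEE_CS_less:
  assumes "a > 0"
  shows "SLEE (CS [a, 1, 0]) < SLEE (CS [Suc a, 0, 0])"
proof -
  let ?G = "CS [a, 1, 0]" and ?H = "CS [Suc a, 0, 0]" and ?q = "(Suc 0, Suc 0)"
  have tri: "is_tri (pverts ?G) (parcs ?G) (0, 0) (Suc 0, 0) (2, 0) (Pair 0 ` {1..a}) {?q}"
    using CS_is_tri[of a 1] by simp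
  let ?E = "shift (0, 0) (Suc 0, 0) {?q} (parcs ?G)"
  have "SLEE ?G < slee (pverts ?G) ?E"
    using slee_tri_absorb_less[OF tri] assms by (simp add: graph_record_eta)
  also have "slee (pverts ?G) ?E = slee (pverts ?H) (parcs ?H)"
  proof (rule SLEE_graph_iso)
    have tri': "is_tri (pverts ?G) ?E (0, 0) (Suc 0, 0) (2, 0) (Pair 0 ` {1..a} \<union> {?q}) {}"
      using is_tri_shift[OF tri subset_refl] by simp
    have "?q \<notin> Pair 0 ` {1..a}" by auto
    then have "card (Pair 0 ` {1..a} \<union> {?q}) = Suc a"
      by (simp add: card_image inj_on_def)
    then show "graph_iso \<lparr>pverts = pverts ?G, parcs = ?E\<rparr> \<lparr>pverts = pverts ?H, parcs = parcs ?H\<rparr>"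
      by (intro is_tri_iso[OF tri' CS_is_tri]) (simp_all add: card_image inj_on_def)
    show "sgraph (pverts \<lparr>pverts = pverts ?G, parcs = ?E\<rparr>) (parcs \<lparr>pverts = pverts ?G, parcs = ?E\<rparr>)"
      using is_tri_sgraph[OF tri'] by simp
    show "sgraph (pverts \<lparr>pverts = pverts ?H, parcs = parcs ?H\<rparr>) (parcs \<lparr>pverts = pverts ?H, parcs = parcs ?H\<rparr>)"
      using is_tri_sgraph[OF CS_is_tri] by simp
  qed
  finally show ?thesis by (simp add: graph_record_eta)
qed

lemma is_tri_graph_iso_CS:
  assumes "is_tri (pverts G) (parcs G) u v y P Q"
  shows "graph_iso G (CS [card P, card Q, 0])"
  using is_tri_iso[OF assms CS_is_tri[of "card P" "card Q"]]
  by (simp add: card_image inj_on_def graph_record_eta)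

theorem theorem3p3:
  fixes G :: "'a pair_pre_digraph" and n :: nat
  assumes "unicyclic G" and "card (pverts G) = n"
    and "\<not> graph_iso G (CS [n - 3, 0, 0])"
  shows "SLEE G \<le> SLEE (CS [n - 4, 1, 0])
    \<and> (n \<ge> 5 \<longrightarrow> SLEE (CS [n - 4, 1, 0]) < SLEE (CS [n - 3, 0, 0]))
    \<and> (SLEE G = SLEE (CS [n - 4, 1, 0]) \<longleftrightarrow> graph_iso G (CS [n - 4, 1, 0]))"
proof -
  let ?V = "pverts G" and ?E = "parcs G" and ?H = "CS [n - 4, 1, 0]"
  have G: "unicyc ?V ?E" by (rule unicyclic_imp_unicyc[OF assms(1)])
  have sg: "sgraph ?V ?E" using G by (simp add: unicyc_def)
  have sH: "sgraph (pverts ?H) (parcs ?H)" by (rule is_tri_sgraph[OF CS_is_tri])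
  have dominated: "\<exists>u v y P. is_tri ?V F u v y P {}" if "unicyc ?V F" "\<not> no_dominating ?V F" for F
  proof -
    from that(2) obtain u where "u \<in> ?V" "\<And>x. x \<in> ?V \<Longrightarrow> x \<noteq> u \<Longrightarrow> (u, x) \<in> F"
      by (auto simp: no_dominating_def)
    then show ?thesis using unicyc_dominating_is_tri[OF that(1)] by metis
  qed
  have nodom: "no_dominating ?V ?E"
  proof (rule ccontr)
    assume "\<not> ?thesis"
    then obtain u v y P where tri: "is_tri ?V ?E u v y P {}" using dominated[OF G] by blast
    then have "card P = n - 3" using is_tri_card[OF tri] assms(2) by simp
    then show False using is_tri_graph_iso_CS[OF tri] assms(3) by simp
  qed
  \<comment> \<open>On four vertices a transformation may reach \<open>G\<^sup>(\<^sup>1\<^sup>)\<close>, which then is also \<open>G\<^sup>(\<^sup>2\<^sup>)\<close>.\<close>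
  define \<S> where "\<S> = {F. unicyc ?V F \<and> (no_dominating ?V F \<or> card ?V = 4)}"
  have "\<S> \<subseteq> Pow (?V \<times> ?V)" by (auto simp: \<S>_def unicyc_def sgraph_def)
  moreover have "finite (Pow (?V \<times> ?V))" using sg by (simp add: sgraph_def)
  ultimately have fin: "finite \<S>" by (rule finite_subset)
  have GS: "?E \<in> \<S>" using G nodom by (simp add: \<S>_def)
  have max_iso: "graph_iso \<lparr>pverts = ?V, parcs = F\<rparr> ?H"
    if F: "F \<in> \<S>" and max: "\<And>F'. F' \<in> \<S> \<Longrightarrow> slee ?V F' \<le> slee ?V F" for F
  proof -
    have "\<exists>u v y P Q. is_tri ?V F u v y P Q \<and> card Q = 1"
    proof (cases "no_dominating ?V F")
      case True
      obtain u v y P q where "is_tri ?V F u v y P {q}"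
        by (rule maximal_no_dominating_is_tri[of ?V F]) (use True F max in \<open>auto simp: \<S>_def\<close>)
      then show ?thesis by (metis is_singletonI is_singleton_altdef)
    next
      case False
      have uni: "unicyc ?V F" and four: "card ?V = 4" using F False by (auto simp: \<S>_def)
      obtain u v y P where tri: "is_tri ?V F u v y P {}" using dominated[OF uni False] by blast
      then have "card P = 1" using is_tri_card[OF tri] four by simp
      \<comment> \<open>On four vertices the single pendent vertex may be counted on either side.\<close>
      then show ?thesis using is_tri_swap[OF tri] by blast
    qed
    then obtain u v y P Q where tri: "is_tri ?V F u v y P Q" "card Q = 1" by blast
    then have "card P = n - 4" using is_tri_card[OF tri(1)] assms(2) by simp
    moreover have "graph_iso \<lparr>pverts = ?V, parcs = F\<rparr> (CS [card P, card Q, 0])"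
      by (rule is_tri_graph_iso_CS) (use tri(1) in simp)
    ultimately show ?thesis using tri(2) by simp
  qed
  have "Max (slee ?V ` \<S>) \<in> slee ?V ` \<S>" using fin GS by (intro Max_in) auto
  then obtain M where M: "M \<in> \<S>" "slee ?V M = Max (slee ?V ` \<S>)" by auto
  then have maxM: "slee ?V F \<le> slee ?V M" if "F \<in> \<S>" for F using fin that by simp
  have "sgraph ?V M" using M(1) by (simp add: \<S>_def unicyc_def)
  then have SM: "slee ?V M = SLEE ?H"
    using SLEE_graph_iso[OF max_iso[OF M(1) maxM] _ sH] by simp
  have le: "SLEE G \<le> SLEE ?H" using maxM[OF GS] SM by (simp add: graph_record_eta)
  have "graph_iso G ?H" if "SLEE G = SLEE ?H"
    using max_iso[OF GS] maxM that SM by (simp add: graph_record_eta)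
  moreover have "SLEE G = SLEE ?H" if "graph_iso G ?H" by (rule SLEE_graph_iso[OF that sg sH])
  moreover have "SLEE ?H < SLEE (CS [n - 3, 0, 0])" if "n \<ge> 5"
  proof -
    have "Suc (n - 4) = n - 3" using that by simp
    then show ?thesis using SLEE_CS_less[of "n - 4"] that by simp
  qed
  ultimately show ?thesis using le by blast
qed

end
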